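(* Let $q>1$, let $\Omega$ be any domain of $\mathbb{R}^N$, $T\in(0,\infty]$, and let $u$ be any nonnegative weak solution of (E) in $Q_{\Omega,T}$. Then there exist a set $\mathcal{S}\subset\Omega$ such that $\mathcal{R}=\Omega\setminus\mathcal{S}$ is open, and a measure $u_0\in\mathcal{M}^+(\mathcal{R})$, such that (a) for every $\psi\in C_c(\mathcal{R})$, $\lim_{t\to0}\int_{\mathcal{R}}u(\cdot,t)\psi\,dx=\int_{\mathcal{R}}\psi\,du_0$; (b) for every $x_0\in\mathcal{S}$ and every $\varepsilon>0$, $\lim_{t\to0}\int_{B(x_0,\varepsilon)\cap\Omega}u(\cdot,t)\,dx=\infty$.
   Context: Equation (E) is $u_t-\Delta u+|\nabla u|^q=0$ and $Q_{\Omega,T}=\Omega\times(0,T)$. A weak solution of (E) in $Q_{\Omega,T}$ is a function $u\in C((0,T);L^1_{loc}(\Omega))\cap L^1_{loc}((0,T);W^{1,1}_{loc}(\Omega))$ with $|\nabla u|^q\in L^1_{loc}(Q_{\Omega,T})$ such that $\int_0^T\int_\Omega(-u\varphi_t-u\Delta\varphi+|\nabla u|^q\varphi)\,dx\,dt=0$ for all $\varphi\in C_c^\infty(Q_{\Omega,T})$. $\mathcal{M}^+(A)$ denotes the nonnegative Radon measures on an open set $A$. *)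

theory Defs
  imports "HOL-Analysis.Analysis"
begin

fun dderiv :: "'a::euclidean_space list \<Rightarrow> ('a \<Rightarrow> real) \<Rightarrow> 'a \<Rightarrow> real" where
  "dderiv [] f = f"
| "dderiv (v # vs) f = (\<lambda>x. frechet_derivative (dderiv vs f) (at x) v)"

definition smooth :: "('a::euclidean_space \<Rightarrow> real) \<Rightarrow> bool" where
  "smooth f \<longleftrightarrow> (\<forall>vs. set vs \<subseteq> Basis \<longrightarrow>
      (\<forall>x. dderiv vs f differentiable at x) \<and> continuous_on UNIV (dderiv vs f))"

definition test_fun :: "'a::euclidean_space set \<Rightarrow> ('a \<Rightarrow> real) \<Rightarrow> bool" where
  "test_fun A \<phi> \<longleftrightarrow> smooth \<phi> \<and> compact (closure {z. \<phi> z \<noteq> 0})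
      \<and> closure {z. \<phi> z \<noteq> 0} \<subseteq> A"

definition tint :: "ereal \<Rightarrow> real set" where
  "tint T = {t. 0 < t \<and> ereal t < T}"

definition cyl :: "'a set \<Rightarrow> ereal \<Rightarrow> ('a \<times> real) set" where
  "cyl \<Omega> T = \<Omega> \<times> tint T"

text \<open>Weak solution of u_t - Delta u + |grad u|^q = 0 in Q = Omega x (0,T).
  u is written u x t.  g is the (distributional) spatial gradient of u.\<close>
definition weak_solution :: "real \<Rightarrow> 'a::euclidean_space set \<Rightarrow> ereal \<Rightarrow> ('a \<Rightarrow> real \<Rightarrow> real) \<Rightarrow> bool" where
  "weak_solution q \<Omega> T u \<longleftrightarrow>
    \<comment> \<open>u in C((0,T); L^1_loc(Omega))\<close>
    (\<forall>K t. compact K \<and> K \<subseteq> \<Omega> \<and> t \<in> tint T \<longrightarrow>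
        set_integrable lborel K (\<lambda>x. u x t) \<and>
        ((\<lambda>s. LINT x:K|lborel. \<bar>u x s - u x t\<bar>) \<longlongrightarrow> 0) (at t within tint T)) \<and>
    (\<exists>g :: 'a \<Rightarrow> real \<Rightarrow> 'a.
       \<comment> \<open>u, grad u in L^1_loc, and |grad u|^q in L^1_loc(Q)\<close>
       (\<forall>K. compact K \<and> K \<subseteq> cyl \<Omega> T \<longrightarrow>
          set_integrable lborel K (\<lambda>z. u (fst z) (snd z)) \<and>
          set_integrable lborel K (\<lambda>z. g (fst z) (snd z)) \<and>
          set_integrable lborel K (\<lambda>z. norm (g (fst z) (snd z)) powr q)) \<and>
       \<comment> \<open>g is the weak spatial gradient of u\<close>
       (\<forall>\<phi> b. test_fun (cyl \<Omega> T) \<phi> \<and> b \<in> Basis \<longrightarrow>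
          (LINT z|lborel. u (fst z) (snd z) * dderiv [(b, 0)] \<phi> z)
            = - (LINT z|lborel. (g (fst z) (snd z) \<bullet> b) * \<phi> z)) \<and>
       \<comment> \<open>the weak form of the equation\<close>
       (\<forall>\<phi>. test_fun (cyl \<Omega> T) \<phi> \<longrightarrow>
          (LINT z|lborel. - u (fst z) (snd z) * dderiv [(0, 1)] \<phi> z
              - u (fst z) (snd z) * (\<Sum>b\<in>Basis. dderiv [(b, 0), (b, 0)] \<phi> z)
              + norm (g (fst z) (snd z)) powr q * \<phi> z) = 0))"

text \<open>Nonnegative Radon measures on an open set R, realised as Borel measures on the
  whole space that vanish outside R and are finite on compact subsets of R.\<close>
definition radon_pos_on :: "'a::euclidean_space set \<Rightarrow> 'a measure \<Rightarrow> bool" where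
  "radon_pos_on R \<mu> \<longleftrightarrow> sets \<mu> = sets borel \<and> emeasure \<mu> (UNIV - R) = 0 \<and>
     (\<forall>K. compact K \<and> K \<subseteq> R \<longrightarrow> emeasure \<mu> K < \<infinity>)"

text \<open>C_c(R): continuous on R with compact support inside R (values off R irrelevant).\<close>
definition Cc_on :: "'a::euclidean_space set \<Rightarrow> ('a \<Rightarrow> real) \<Rightarrow> bool" where
  "Cc_on R \<psi> \<longleftrightarrow> continuous_on R \<psi> \<and> (\<exists>K. compact K \<and> K \<subseteq> R \<and> (\<forall>x\<in>R - K. \<psi> x = 0))"

end

theory Submission
  imports Defs
begin

text \<open>
  Call a point of \<open>\<Omega>\<close> regular if \<open>|\<nabla>u|^q\<close> is integrable on \<open>U \<times> (0,\<tau>]\<close> for some neighbourhood \<open>U\<close>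
  of it and some \<open>\<tau>\<close>; the regular points form the open set \<open>R\<close>, and \<open>S\<close> is the rest of \<open>\<Omega>\<close>.
  Testing the equation with \<open>\<xi>(x) \<theta>(t)\<close>, where \<open>\<theta>\<close> approximates the indicator function of an
  interval, gives \<open>\<integral>u(s)\<xi> - \<integral>u(t)\<xi> = \<integral>_s^t \<integral> (\<nabla>u \<cdot> \<nabla>\<xi> + |\<nabla>u|^q \<xi>)\<close>.

  If \<open>\<xi>\<close> is supported in \<open>R\<close>, the integrand on the right is dominated by a multiple of
  \<open>1 + |\<nabla>u|^q\<close>, so \<open>\<integral>u(s)\<xi>\<close> converges as \<open>s \<rightarrow> 0\<close>.  Test functions are dense in \<open>C_c(R)\<close>, with
  errors controlled by a fixed nonnegative test function, so positivity extends the convergence to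
  \<open>C_c(R)\<close>; the limit is a positive functional, hence a Radon measure.

  Near a point of \<open>S\<close> take \<open>\<xi> = \<eta>^(n+1)\<close> with \<open>n \<ge> 1/(q - 1)\<close>.  Young's inequality absorbs the
  gradient term: \<open>|\<nabla>u \<cdot> \<nabla>\<xi>| \<le> |\<nabla>u|^q \<xi> / q + C\<close>, and \<open>\<integral>u(s)\<xi>\<close> grows at least like a multiple of
  the divergent integral of \<open>|\<nabla>u|^q \<xi>\<close>.
\<close>

section \<open>Smooth functions\<close>

declare dderiv.simps(2) [simp del]

lemma dderiv_singleton: "dderiv [v] f x = frechet_derivative f (at x) v"
  by (simp add: dderiv.simps(2))

lemma dderiv_eqI: "(f has_derivative f') (at x) \<Longrightarrow> dderiv [v] f x = f' v"
  by (metis dderiv_singleton frechet_derivative_at)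

lemma dderiv_append: "dderiv (vs @ ws) f = dderiv vs (dderiv ws f)"
  by (induction vs) (auto simp: dderiv.simps(2))

lemma dderiv_locally_const:
  assumes "open V" "x \<in> V" "\<And>y. y \<in> V \<Longrightarrow> f y = c"
  shows "dderiv [v] f x = 0"
proof (rule dderiv_eqI)
  have "((\<lambda>_. c) has_derivative (\<lambda>_. 0)) (at x)"
    by simp
  then show "(f has_derivative (\<lambda>_. 0)) (at x)"
    by (rule has_derivative_transform_within_open[OF _ assms(1,2)]) (simp add: assms(3))
qed

text \<open>Continuity of the derivatives is automatic from their differentiability.\<close>
lemma smooth_coinduct:
  assumes "f \<in> \<F>"
    and differentiable: "\<And>f x. f \<in> \<F> \<Longrightarrow> f differentiable at x"
    and dderiv_closed: "\<And>f b. f \<in> \<F> \<Longrightarrow> b \<in> Basis \<Longrightarrow> dderiv [b] f \<in> \<F>"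
  shows "smooth f"
proof -
  have "dderiv vs f \<in> \<F>" if "set vs \<subseteq> Basis" for vs
    using that
  proof (induction vs)
    case (Cons v vs)
    then show ?case
      using dderiv_closed dderiv_append[of "[v]" vs f] by simp
  qed (use \<open>f \<in> \<F>\<close> in simp)
  then have "dderiv vs f differentiable at x" if "set vs \<subseteq> Basis" for vs x
    using that differentiable by blast
  then show ?thesis
    unfolding smooth_def
    by (auto intro!: differentiable_imp_continuous_on
        simp: differentiable_on_def intro: differentiable_at_withinI)
qed

lemma smooth_differentiable: "smooth f \<Longrightarrow> f differentiable at x"
  unfolding smooth_def by (metis dderiv.simps(1) empty_subsetI list.set(1))

lemma smooth_continuous_on: "smooth f \<Longrightarrow> continuous_on A f"
  by (meson differentiable_at_withinI differentiable_imp_continuous_on differentiable_on_def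
      smooth_differentiable)

lemma smooth_dderiv: "smooth f \<Longrightarrow> b \<in> Basis \<Longrightarrow> smooth (dderiv [b] f)"
  unfolding smooth_def dderiv_append[symmetric] by simp

lemma smooth_has_derivative:
  fixes f :: "'a::euclidean_space \<Rightarrow> real"
  assumes "smooth f"
  shows "(f has_derivative (\<lambda>v. \<Sum>b\<in>Basis. (v \<bullet> b) * dderiv [b] f x)) (at x)"
proof -
  have "frechet_derivative f (at x) v = (\<Sum>b\<in>Basis. (v \<bullet> b) * dderiv [b] f x)" for v
  proof -
    have "linear (frechet_derivative f (at x))"
      by (rule linear_frechet_derivative[OF smooth_differentiable[OF assms]])
    then have "frechet_derivative f (at x) (\<Sum>b\<in>Basis. (v \<bullet> b) *\<^sub>R b)
        = (\<Sum>b\<in>Basis. (v \<bullet> b) * dderiv [b] f x)"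
      by (simp add: linear_sum linear_scale dderiv_singleton)
    then show ?thesis
      by (simp add: euclidean_representation)
  qed
  then have "frechet_derivative f (at x) = (\<lambda>v. \<Sum>b\<in>Basis. (v \<bullet> b) * dderiv [b] f x)"
    by blast
  then show ?thesis
    using smooth_differentiable[OF assms, of x] by (metis frechet_derivative_works)
qed

lemma smooth_has_real_derivative:
  "smooth f \<Longrightarrow> (f has_real_derivative dderiv [1] f x) (at x)"
  by (rule has_derivative_imp_has_field_derivative[OF smooth_has_derivative]) simp_all

lemma dderiv_real_eqI: "(f has_real_derivative D) (at x) \<Longrightarrow> dderiv [1] f x = D"
  using dderiv_eqI[of f "(*) D" x 1] by (simp add: has_field_derivative_def)

inductive_set fun_algebra :: "('a \<Rightarrow> real) set \<Rightarrow> ('a \<Rightarrow> real) set" for \<G> where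
  gen: "f \<in> \<G> \<Longrightarrow> f \<in> fun_algebra \<G>"
| const: "(\<lambda>_. c) \<in> fun_algebra \<G>"
| add: "f \<in> fun_algebra \<G> \<Longrightarrow> h \<in> fun_algebra \<G> \<Longrightarrow> (\<lambda>x. f x + h x) \<in> fun_algebra \<G>"
| mult: "f \<in> fun_algebra \<G> \<Longrightarrow> h \<in> fun_algebra \<G> \<Longrightarrow> (\<lambda>x. f x * h x) \<in> fun_algebra \<G>"

lemma fun_algebra_sum:
  "(\<And>i. i \<in> I \<Longrightarrow> f i \<in> fun_algebra \<G>) \<Longrightarrow> (\<lambda>x. \<Sum>i\<in>I. f i x) \<in> fun_algebra \<G>"
  by (induction I rule: infinite_finite_induct) (auto intro: fun_algebra.intros)

text \<open>By Leibniz' rule, it suffices to differentiate the generators.\<close>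
lemma smooth_fun_algebra:
  fixes \<G> :: "('a::euclidean_space \<Rightarrow> real) set"
  assumes "f \<in> fun_algebra \<G>"
    and gen_differentiable: "\<And>f x. f \<in> \<G> \<Longrightarrow> f differentiable at x"
    and gen_dderiv: "\<And>f b. f \<in> \<G> \<Longrightarrow> b \<in> Basis \<Longrightarrow> dderiv [b] f \<in> fun_algebra \<G>"
  shows "smooth f"
proof (rule smooth_coinduct[OF assms(1)])
  have closure: "(\<forall>x. f differentiable at x) \<and> (\<forall>b\<in>Basis. dderiv [b] f \<in> fun_algebra \<G>)"
    if "f \<in> fun_algebra \<G>" for f
    using that
  proof induction
    case (gen f)
    then show ?case
      using gen_differentiable gen_dderiv by blast
  next
    case (const c)
    have "dderiv [b] (\<lambda>_::'a. c) = (\<lambda>_. 0)" for b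
      by (rule ext) (simp add: dderiv_eqI[OF has_derivative_const])
    then show ?case
      by (simp add: fun_algebra.const)
  next
    case (add f h)
    then have "((\<lambda>x. f x + h x) has_derivative
        (\<lambda>v. dderiv [v] f x + dderiv [v] h x)) (at x)" for x
      by (auto intro!: has_derivative_add simp: dderiv_singleton frechet_derivative_works[symmetric])
    from dderiv_eqI[OF this]
    have "dderiv [b] (\<lambda>x. f x + h x) = (\<lambda>x. dderiv [b] f x + dderiv [b] h x)" for b
      by blast
    then show ?case
      using add by (auto intro: fun_algebra.add)
  next
    case (mult f h)
    then have "((\<lambda>x. f x * h x) has_derivative
        (\<lambda>v. f x * dderiv [v] h x + dderiv [v] f x * h x)) (at x)" for x
      by (auto intro!: has_derivative_mult simp: dderiv_singleton frechet_derivative_works[symmetric])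
    from dderiv_eqI[OF this]
    have "dderiv [b] (\<lambda>x. f x * h x) = (\<lambda>x. f x * dderiv [b] h x + dderiv [b] f x * h x)" for b
      by blast
    then show ?case
      using mult by (auto intro!: fun_algebra.add fun_algebra.mult)
  qed
  show "f differentiable at x" if "f \<in> fun_algebra \<G>" for f x
    using closure[OF that] by blast
  show "dderiv [b] f \<in> fun_algebra \<G>" if "f \<in> fun_algebra \<G>" "b \<in> Basis" for f b
    using closure[OF that(1)] that(2) by blast
qed

lemma smooth_fun_algebra_smooth: "f \<in> fun_algebra (Collect smooth) \<Longrightarrow> smooth f"
  by (rule smooth_fun_algebra[of f "Collect smooth"])
    (simp_all add: fun_algebra.gen smooth_differentiable smooth_dderiv)

lemma smooth_const: "smooth (\<lambda>_. c)"
  by (rule smooth_fun_algebra_smooth[OF fun_algebra.const])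

lemma smooth_add: "smooth f \<Longrightarrow> smooth h \<Longrightarrow> smooth (\<lambda>x. f x + h x)"
  by (rule smooth_fun_algebra_smooth[OF fun_algebra.add]) (auto intro: fun_algebra.gen)

lemma smooth_mult: "smooth f \<Longrightarrow> smooth h \<Longrightarrow> smooth (\<lambda>x. f x * h x)"
  by (rule smooth_fun_algebra_smooth[OF fun_algebra.mult]) (auto intro: fun_algebra.gen)

lemma smooth_sum: "(\<And>i. i \<in> I \<Longrightarrow> smooth (f i)) \<Longrightarrow> smooth (\<lambda>x. \<Sum>i\<in>I. f i x)"
  by (rule smooth_fun_algebra_smooth[OF fun_algebra_sum]) (auto intro: fun_algebra.gen)

lemma smooth_diff: "smooth f \<Longrightarrow> smooth h \<Longrightarrow> smooth (\<lambda>x. f x - h x)"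
  using smooth_add[of f "\<lambda>x. -1 * h x"] smooth_mult[OF smooth_const[of "-1"], of h] by simp

lemma smooth_power: "smooth f \<Longrightarrow> smooth (\<lambda>x. f x ^ n)"
  by (induction n) (auto intro: smooth_const smooth_mult)

lemma smooth_bounded_linear:
  fixes f :: "'a::euclidean_space \<Rightarrow> real"
  assumes "bounded_linear f"
  shows "smooth f"
proof (rule smooth_coinduct[of f "insert f (Collect smooth)"])
  have derivative: "(f has_derivative f) (at x)" for x
    by (rule bounded_linear_imp_has_derivative[OF assms])
  show "h differentiable at x" if "h \<in> insert f (Collect smooth)" for h x
    using that derivative by (auto intro: differentiableI smooth_differentiable)
  have "dderiv [b] f = (\<lambda>_. f b)" for b
    by (rule ext) (rule dderiv_eqI[OF derivative])
  then show "dderiv [b] h \<in> insert f (Collect smooth)"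
    if "h \<in> insert f (Collect smooth)" "b \<in> Basis" for h b
    using that by (auto intro: smooth_const smooth_dderiv)
qed simp

lemma smooth_real_polynomial_function:
  fixes f :: "'a::euclidean_space \<Rightarrow> real"
  assumes "real_polynomial_function f"
  shows "smooth f"
  using assms
  by (induction rule: real_polynomial_function.induct)
    (auto intro: smooth_const smooth_add smooth_mult smooth_bounded_linear)

lemma has_derivative_smooth_compose:
  fixes k :: "'b::euclidean_space \<Rightarrow> real" and f :: "'a::euclidean_space \<Rightarrow> 'b"
  assumes "smooth k" and components: "\<And>i. i \<in> Basis \<Longrightarrow> smooth (\<lambda>x. f x \<bullet> i)"
  shows "((\<lambda>x. k (f x)) has_derivative
    (\<lambda>v. \<Sum>i\<in>Basis. dderiv [v] (\<lambda>x. f x \<bullet> i) x * dderiv [i] k (f x))) (at x)"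
proof -
  define f' where "f' v = (\<Sum>i\<in>Basis. dderiv [v] (\<lambda>x. f x \<bullet> i) x *\<^sub>R i)" for v
  have "(f has_derivative f') (at x)"
    unfolding has_derivative_componentwise_within[of f f']
    using components by (auto simp: f'_def dderiv_singleton frechet_derivative_works[symmetric]
        intro: smooth_differentiable)
  from has_derivative_compose[OF this smooth_has_derivative[OF assms(1)]]
  show ?thesis
    by (simp add: f'_def)
qed

lemma smooth_compose:
  fixes k :: "'b::euclidean_space \<Rightarrow> real" and f :: "'a::euclidean_space \<Rightarrow> 'b"
  assumes "smooth k" and components: "\<And>i. i \<in> Basis \<Longrightarrow> smooth (\<lambda>x. f x \<bullet> i)"
  shows "smooth (\<lambda>x. k (f x))"
proof (rule smooth_fun_algebra[of _ "{\<lambda>x. k (f x) | k. smooth k} \<union> Collect smooth"])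
  let ?\<G> = "{\<lambda>x. k (f x) | k. smooth k} \<union> Collect smooth"
  show "(\<lambda>x. k (f x)) \<in> fun_algebra ?\<G>"
    using assms(1) by (auto intro: fun_algebra.gen)
  show "h differentiable at x" if "h \<in> ?\<G>" for h x
    using that has_derivative_smooth_compose[OF _ components] smooth_differentiable
    unfolding differentiable_def by blast
  show "dderiv [b] h \<in> fun_algebra ?\<G>" if "h \<in> ?\<G>" and b: "b \<in> Basis" for h b
    using \<open>h \<in> ?\<G>\<close>
  proof
    assume "h \<in> {\<lambda>x. k (f x) | k. smooth k}"
    then obtain k where h: "h = (\<lambda>x. k (f x))" and k: "smooth k"
      by blast
    have "dderiv [b] h = (\<lambda>x. \<Sum>i\<in>Basis. dderiv [b] (\<lambda>x. f x \<bullet> i) x * dderiv [i] k (f x))"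
      unfolding h
      by (rule ext) (rule dderiv_eqI[OF has_derivative_smooth_compose[OF k components]])
    also have "\<dots> \<in> fun_algebra ?\<G>"
    proof (intro fun_algebra_sum fun_algebra.mult fun_algebra.gen)
      fix i :: 'b assume i: "i \<in> Basis"
      show "dderiv [b] (\<lambda>x. f x \<bullet> i) \<in> ?\<G>"
        using smooth_dderiv[OF components[OF i] b] by simp
      show "(\<lambda>x. dderiv [i] k (f x)) \<in> ?\<G>"
        using smooth_dderiv[OF k i] by blast
    qed
    finally show ?thesis .
  qed (use b in \<open>auto intro: fun_algebra.gen smooth_dderiv\<close>)
qed

lemma smooth_compose_bounded_linear:
  fixes k :: "'b::euclidean_space \<Rightarrow> real" and A :: "'a::euclidean_space \<Rightarrow> 'b"
  assumes "smooth k" "bounded_linear A"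
  shows "smooth (\<lambda>x. k (A x))"
  by (rule smooth_compose[OF assms(1)], rule smooth_bounded_linear)
    (rule bounded_linear_inner_left_comp[OF assms(2)])

lemma smooth_inverse:
  fixes f :: "'a::euclidean_space \<Rightarrow> real"
  assumes "smooth f" and nonzero: "\<And>x. f x \<noteq> 0"
  shows "smooth (\<lambda>x. inverse (f x))"
proof (rule smooth_fun_algebra[of _ "insert (\<lambda>x. inverse (f x)) (Collect smooth)"])
  let ?\<G> = "insert (\<lambda>x. inverse (f x)) (Collect smooth)"
  have derivative: "((\<lambda>x. inverse (f x)) has_derivative
      (\<lambda>v. - (inverse (f x) * frechet_derivative f (at x) v * inverse (f x)))) (at x)" for x
    using smooth_differentiable[OF assms(1)] nonzero
    by (intro Deriv.has_derivative_inverse) (auto simp: frechet_derivative_works)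
  show "(\<lambda>x. inverse (f x)) \<in> fun_algebra ?\<G>"
    by (auto intro: fun_algebra.gen)
  show "h differentiable at x" if "h \<in> ?\<G>" for h x
    using that derivative by (auto intro: differentiableI smooth_differentiable)
  show "dderiv [b] h \<in> fun_algebra ?\<G>" if "h \<in> ?\<G>" and b: "b \<in> Basis" for h b
  proof -
    have "dderiv [b] (\<lambda>x. inverse (f x)) = (\<lambda>x. (-1) * (inverse (f x) * dderiv [b] f x * inverse (f x)))"
      by (rule ext) (simp add: dderiv_eqI[OF derivative] dderiv_singleton)
    also have "\<dots> \<in> fun_algebra ?\<G>"
      using smooth_dderiv[OF assms(1) b]
      by (intro fun_algebra.mult[OF fun_algebra.const] fun_algebra.mult fun_algebra.gen) auto
    finally show ?thesis
      using that smooth_dderiv[of h b] by (auto intro: fun_algebra.gen)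
  qed
qed

definition flat :: "real poly \<Rightarrow> real \<Rightarrow> real" where
  "flat p s = (if 0 < s then poly p (inverse s) * exp (- inverse s) else 0)"

lemma flat_1_nonneg: "0 \<le> flat 1 s"
  and flat_1_le_1: "flat 1 s \<le> 1"
  and flat_1_eq_0_iff: "flat 1 s = 0 \<longleftrightarrow> s \<le> 0"
  by (auto simp: flat_def)

lemma tendsto_poly_mult_exp_minus: "((\<lambda>y::real. poly p y * exp (- y)) \<longlongrightarrow> 0) at_top"
proof -
  have "((\<lambda>y::real. \<Sum>i\<le>degree p. coeff p i * (y ^ i / exp y)) \<longlongrightarrow> (\<Sum>i\<le>degree p. coeff p i * 0)) at_top"
    by (intro tendsto_intros tendsto_power_div_exp_0)
  then show ?thesis
    by (simp add: poly_altdef exp_minus sum_divide_distrib divide_inverse[symmetric])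
qed

lemma flat_has_real_derivative_0: "(flat p has_real_derivative 0) (at 0)"
proof -
  have "\<forall>\<^sub>F x in at_left 0. flat p x / x = 0"
    by (auto simp: flat_def eventually_at_left_field intro: exI[of _ "-1"])
  then have left: "((\<lambda>x. flat p x / x) \<longlongrightarrow> 0) (at_left 0)"
    by (rule tendsto_eventually)
  have "((\<lambda>x. poly ([:0,1:] * p) (inverse x) * exp (- inverse x)) \<longlongrightarrow> 0) (at_right (0::real))"
    by (rule filterlim_compose[OF tendsto_poly_mult_exp_minus filterlim_inverse_at_top_right])
  moreover have "\<forall>\<^sub>F x in at_right 0. poly ([:0,1:] * p) (inverse x) * exp (- inverse x) = flat p x / x"
    by (auto simp: flat_def field_simps eventually_at_right_field intro: exI[of _ 1])
  ultimately have right: "((\<lambda>x. flat p x / x) \<longlongrightarrow> 0) (at_right 0)"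
    by (rule Lim_transform_eventually)
  from left right have "((\<lambda>x. flat p x / x) \<longlongrightarrow> 0) (at 0)"
    by (simp add: filterlim_at_split)
  then show ?thesis
    by (simp add: has_field_derivative_iff flat_def)
qed

lemma flat_has_real_derivative:
  "(flat p has_real_derivative flat ([:0,0,1:] * (p - pderiv p)) s) (at s)"
proof -
  consider "s > 0" | "s < 0" | "s = 0"
    by linarith
  then show ?thesis
  proof cases
    assume "s > 0"
    then have "((\<lambda>s. poly p (inverse s) * exp (- inverse s)) has_real_derivative
        flat ([:0,0,1:] * (p - pderiv p)) s) (at s)"
      by (auto intro!: derivative_eq_intros DERIV_chain2[OF poly_DERIV]
          simp: flat_def power2_eq_square algebra_simps)
    then show ?thesis
      by (rule has_field_derivative_transform_within_open[of _ _ _ "{0<..}"])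
        (use \<open>s > 0\<close> in \<open>auto simp: flat_def\<close>)
  next
    assume "s < 0"
    then have "((\<lambda>_. 0) has_real_derivative flat ([:0,0,1:] * (p - pderiv p)) s) (at s)"
      by (simp add: flat_def)
    then show ?thesis
      by (rule has_field_derivative_transform_within_open[of _ _ _ "{..<0}"])
        (use \<open>s < 0\<close> in \<open>auto simp: flat_def\<close>)
  next
    assume "s = 0"
    then show ?thesis
      using flat_has_real_derivative_0[of p] by (simp add: flat_def)
  qed
qed

lemma smooth_flat: "smooth (flat p)"
proof (rule smooth_coinduct[of _ "range flat"])
  show "h differentiable at x" if "h \<in> range flat" for h x
    using that flat_has_real_derivative by (auto simp: real_differentiable_def)
  show "dderiv [b] h \<in> range flat" if "h \<in> range flat" "b \<in> Basis" for h b
    using that dderiv_real_eqI[OF flat_has_real_derivative] by (auto simp: fun_eq_iff)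
qed simp

definition smooth_step :: "real \<Rightarrow> real" where
  "smooth_step s = flat 1 s * inverse (flat 1 s + flat 1 (1 - s))"

lemma smooth_step_denominator_pos: "0 < flat 1 s + flat 1 (1 - s)"
  using flat_1_nonneg[of s] flat_1_nonneg[of "1 - s"] flat_1_eq_0_iff[of s] flat_1_eq_0_iff[of "1 - s"]
  by linarith

lemma smooth_smooth_step: "smooth smooth_step"
proof -
  have "smooth (\<lambda>s. flat 1 (1 - s))"
    by (rule smooth_compose[OF smooth_flat])
      (simp add: smooth_diff smooth_const smooth_bounded_linear)
  then show ?thesis
    unfolding smooth_step_def[abs_def] using smooth_step_denominator_pos
    by (intro smooth_mult smooth_inverse smooth_add smooth_flat) (auto simp: less_le)
qed

lemma smooth_step_eq_0: "s \<le> 0 \<Longrightarrow> smooth_step s = 0"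
  by (simp add: smooth_step_def flat_def)

lemma smooth_step_eq_1: "1 \<le> s \<Longrightarrow> smooth_step s = 1"
  by (simp add: smooth_step_def flat_def)

lemma smooth_step_nonneg: "0 \<le> smooth_step s"
  using smooth_step_denominator_pos[of s] by (simp add: smooth_step_def flat_1_nonneg)

lemma smooth_step_le_1: "smooth_step s \<le> 1"
  using smooth_step_denominator_pos[of s] flat_1_nonneg[of "1 - s"]
  by (simp add: smooth_step_def divide_inverse[symmetric])

lemma smooth_bump:
  fixes x0 :: "'a::euclidean_space"
  assumes "0 < r"
  obtains \<eta> where "smooth \<eta>" "\<And>x. 0 \<le> \<eta> x" "\<And>x. \<eta> x \<le> 1" "\<And>x. \<eta> x = 0 \<longleftrightarrow> x \<notin> ball x0 r"
proof
  let ?\<eta> = "\<lambda>x. flat 1 (r\<^sup>2 - (dist x x0)\<^sup>2)"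
  have "(dist x x0)\<^sup>2 = (\<Sum>b\<in>Basis. ((x - x0) \<bullet> b) * ((x - x0) \<bullet> b))" for x
    by (metis dist_norm euclidean_inner power2_norm_eq_inner)
  then have "(\<lambda>x. r\<^sup>2 - (dist x x0)\<^sup>2)
      = (\<lambda>x. r\<^sup>2 - (\<Sum>b\<in>Basis. (x \<bullet> b - x0 \<bullet> b) * (x \<bullet> b - x0 \<bullet> b)))"
    by (simp only: inner_diff_left)
  moreover have "smooth \<dots>"
    by (intro smooth_diff smooth_const smooth_sum smooth_mult smooth_bounded_linear
        bounded_linear_inner_left)
  ultimately show "smooth ?\<eta>"
    by (intro smooth_compose[OF smooth_flat, of "\<lambda>x. r\<^sup>2 - (dist x x0)\<^sup>2"]) simp
  show "?\<eta> x = 0 \<longleftrightarrow> x \<notin> ball x0 r" for x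
    using assms by (simp add: flat_1_eq_0_iff not_less dist_commute)
qed (rule flat_1_nonneg flat_1_le_1)+

section \<open>Compactly supported functions\<close>

definition Cc :: "'a::euclidean_space set \<Rightarrow> ('a \<Rightarrow> real) set" where
  "Cc R = {f. continuous_on UNIV f \<and> (\<exists>K. compact K \<and> K \<subseteq> R \<and> (\<forall>x. x \<notin> K \<longrightarrow> f x = 0))}"

lemma CcI:
  "continuous_on UNIV f \<Longrightarrow> compact K \<Longrightarrow> K \<subseteq> R \<Longrightarrow> (\<And>x. x \<notin> K \<Longrightarrow> f x = 0) \<Longrightarrow> f \<in> Cc R"
  by (auto simp: Cc_def)

lemma CcE:
  assumes "f \<in> Cc R"
  obtains K where "compact K" "K \<subseteq> R" "\<And>x. x \<notin> K \<Longrightarrow> f x = 0"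
  using assms by (auto simp: Cc_def)

lemma Cc_continuous_on: "f \<in> Cc R \<Longrightarrow> continuous_on A f"
  unfolding Cc_def by (auto intro: continuous_on_subset)

lemma Cc_zero_outside: "f \<in> Cc R \<Longrightarrow> x \<notin> R \<Longrightarrow> f x = 0"
  unfolding Cc_def by blast

lemma Cc_mono: "A \<subseteq> B \<Longrightarrow> Cc A \<subseteq> Cc B"
  unfolding Cc_def by blast

lemma Cc_zero: "(\<lambda>_. 0) \<in> Cc R"
  by (rule CcI[of _ "{}"]) auto

lemma Cc_combine:
  assumes "f \<in> Cc R" "h \<in> Cc R" "continuous_on UNIV (\<lambda>x. F (f x) (h x))" "F 0 0 = 0"
  shows "(\<lambda>x. F (f x) (h x)) \<in> Cc R"
proof -
  obtain K where "compact K" "K \<subseteq> R" "\<And>x. x \<notin> K \<Longrightarrow> f x = 0"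
    using CcE[OF assms(1)] by blast
  moreover obtain K' where "compact K'" "K' \<subseteq> R" "\<And>x. x \<notin> K' \<Longrightarrow> h x = 0"
    using CcE[OF assms(2)] by blast
  ultimately show ?thesis
    using assms(3,4) by (intro CcI[of _ "K \<union> K'"]) auto
qed

lemma Cc_add: "f \<in> Cc R \<Longrightarrow> h \<in> Cc R \<Longrightarrow> (\<lambda>x. f x + h x) \<in> Cc R"
  by (rule Cc_combine[of _ _ _ "(+)"]) (auto intro!: continuous_intros elim: Cc_continuous_on)

lemma Cc_diff: "f \<in> Cc R \<Longrightarrow> h \<in> Cc R \<Longrightarrow> (\<lambda>x. f x - h x) \<in> Cc R"
  by (rule Cc_combine[of _ _ _ "(-)"]) (auto intro!: continuous_intros elim: Cc_continuous_on)

lemma Cc_min_const: "f \<in> Cc R \<Longrightarrow> 0 \<le> c \<Longrightarrow> (\<lambda>x. min (f x) c) \<in> Cc R"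
  by (rule Cc_combine[of _ _ f "\<lambda>y _. min y c"]) (auto intro!: continuous_intros elim: Cc_continuous_on)

lemma Cc_max_zero: "f \<in> Cc R \<Longrightarrow> (\<lambda>x. max (f x) 0) \<in> Cc R"
  by (rule Cc_combine[of _ _ f "\<lambda>y _. max y 0"]) (auto intro!: continuous_intros elim: Cc_continuous_on)

lemma Cc_mult:
  assumes "f \<in> Cc R" "continuous_on UNIV h"
  shows "(\<lambda>x. f x * h x) \<in> Cc R"
proof -
  obtain K where "compact K" "K \<subseteq> R" "\<And>x. x \<notin> K \<Longrightarrow> f x = 0"
    using CcE[OF assms(1)] by blast
  then show ?thesis
    by (intro CcI[of _ K] continuous_on_mult Cc_continuous_on[OF assms(1)] assms(2)) auto
qed

lemma Cc_cmult: "f \<in> Cc R \<Longrightarrow> (\<lambda>x. c * f x) \<in> Cc R"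
  using Cc_mult[of f R "\<lambda>_. c"] by (simp add: mult.commute)

lemma Cc_sum: "(\<And>i. i \<in> I \<Longrightarrow> f i \<in> Cc R) \<Longrightarrow> (\<lambda>x. \<Sum>i\<in>I. f i x) \<in> Cc R"
  by (induction I rule: infinite_finite_induct) (auto intro: Cc_zero Cc_add)

lemma Cc_product:
  assumes "f \<in> Cc A" "h \<in> Cc B"
  shows "(\<lambda>z. f (fst z) * h (snd z)) \<in> Cc (A \<times> B)"
proof -
  obtain K where "compact K" "K \<subseteq> A" "\<And>x. x \<notin> K \<Longrightarrow> f x = 0"
    using CcE[OF assms(1)] by blast
  moreover obtain K' where "compact K'" "K' \<subseteq> B" "\<And>x. x \<notin> K' \<Longrightarrow> h x = 0"
    using CcE[OF assms(2)] by blast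
  moreover have "continuous_on UNIV (\<lambda>z. f (fst z))"
    by (rule continuous_on_compose2[OF Cc_continuous_on[OF assms(1)] _ subset_UNIV])
      (rule continuous_on_fst[OF continuous_on_id])
  moreover have "continuous_on UNIV (\<lambda>z. h (snd z))"
    by (rule continuous_on_compose2[OF Cc_continuous_on[OF assms(2)] _ subset_UNIV])
      (rule continuous_on_snd[OF continuous_on_id])
  ultimately show ?thesis
    by (intro CcI[of _ "K \<times> K'"] compact_Times continuous_on_mult) (auto simp: mem_Times_iff)
qed

lemma Cc_bounded:
  assumes "f \<in> Cc R"
  obtains B where "0 < B" "\<And>x. \<bar>f x\<bar> \<le> B"
proof -
  obtain K where K: "compact K" "K \<subseteq> R" "\<And>x. x \<notin> K \<Longrightarrow> f x = 0"
    using CcE[OF assms] by blast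
  from K(1) have "bounded (f ` K)"
    by (intro compact_imp_bounded compact_continuous_image Cc_continuous_on[OF assms])
  then obtain B where B: "B > 0" "\<And>x. x \<in> K \<Longrightarrow> \<bar>f x\<bar> \<le> B"
    unfolding bounded_pos by auto
  then have "\<bar>f x\<bar> \<le> B" for x
    by (cases "x \<in> K") (auto simp: K(3))
  with B(1) show ?thesis
    by (rule that)
qed

lemma continuous_on_extend_zero:
  fixes f :: "'a::t2_space \<Rightarrow> 'b::{topological_space,zero}"
  assumes "open U" "continuous_on U f" "closed K" "K \<subseteq> U" "\<And>x. x \<notin> K \<Longrightarrow> f x = 0"
  shows "continuous_on UNIV f"
proof -
  have "continuous_on (- K) f"
    by (rule continuous_on_eq[OF continuous_on_const]) (simp add: assms(5))
  then have "continuous_on (U \<union> - K) f"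
    using assms by (intro continuous_on_open_Un) auto
  moreover have "U \<union> - K = UNIV"
    using assms(4) by blast
  ultimately show ?thesis
    by simp
qed

lemma Cc_on_extend_zero:
  assumes "open R" "Cc_on R \<psi>"
  shows "(\<lambda>x. indicator R x *\<^sub>R \<psi> x) \<in> Cc R"
proof -
  obtain K where K: "compact K" "K \<subseteq> R" "\<And>x. x \<in> R - K \<Longrightarrow> \<psi> x = 0"
    using assms(2) unfolding Cc_on_def by blast
  have "continuous_on R (\<lambda>x. indicator R x *\<^sub>R \<psi> x)"
    using assms(2) by (subst continuous_on_cong[OF refl, of _ _ \<psi>]) (auto simp: Cc_on_def)
  moreover have zero_off: "indicator R x *\<^sub>R \<psi> x = 0" if "x \<notin> K" for x
    using K(3)[of x] that by (auto simp: indicator_def)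
  ultimately have "continuous_on UNIV (\<lambda>x. indicator R x *\<^sub>R \<psi> x)"
    using assms(1) K(1,2) by (intro continuous_on_extend_zero[of R _ K] compact_imp_closed) auto
  then show ?thesis
    by (rule CcI[OF _ K(1,2) zero_off])
qed

section \<open>Test functions\<close>

lemma test_fun_iff: "test_fun A \<phi> \<longleftrightarrow> smooth \<phi> \<and> \<phi> \<in> Cc A"
proof
  assume \<phi>: "test_fun A \<phi>"
  have zero_off: "\<phi> x = 0" if "x \<notin> closure {z. \<phi> z \<noteq> 0}" for x
    using that closure_subset[of "{z. \<phi> z \<noteq> 0}"] by blast
  show "smooth \<phi> \<and> \<phi> \<in> Cc A"
  proof
    show smooth: "smooth \<phi>"
      using \<phi> by (simp add: test_fun_def)
    show "\<phi> \<in> Cc A"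
      by (rule CcI[OF smooth_continuous_on[OF smooth] _ _ zero_off])
        (use \<phi> in \<open>simp_all add: test_fun_def\<close>)
  qed
next
  assume \<phi>: "smooth \<phi> \<and> \<phi> \<in> Cc A"
  then obtain K where K: "compact K" "K \<subseteq> A" "\<And>x. x \<notin> K \<Longrightarrow> \<phi> x = 0"
    using CcE[of \<phi> A] by blast
  then have "closure {z. \<phi> z \<noteq> 0} \<subseteq> K"
    by (intro closure_minimal compact_imp_closed) auto
  then show "test_fun A \<phi>"
    using \<phi> K(1,2) compact_Int_closed[OF K(1) closed_closure[of "{z. \<phi> z \<noteq> 0}"]]
    by (simp add: test_fun_def Int_absorb1 subset_trans)
qed

lemma test_fun_smooth: "test_fun A \<phi> \<Longrightarrow> smooth \<phi>"
  and test_fun_Cc: "test_fun A \<phi> \<Longrightarrow> \<phi> \<in> Cc A"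
  by (simp_all add: test_fun_iff)

lemma test_fun_mono: "test_fun A \<phi> \<Longrightarrow> A \<subseteq> B \<Longrightarrow> test_fun B \<phi>"
  unfolding test_fun_def by blast

lemma test_fun_mult: "test_fun A \<phi> \<Longrightarrow> smooth h \<Longrightarrow> test_fun A (\<lambda>x. \<phi> x * h x)"
  by (simp add: test_fun_iff smooth_mult Cc_mult smooth_continuous_on)

lemma test_fun_power_Suc: "test_fun A \<phi> \<Longrightarrow> test_fun A (\<lambda>x. \<phi> x ^ Suc n)"
  using test_fun_mult[of A \<phi> "\<lambda>x. \<phi> x ^ n"] by (simp add: test_fun_smooth smooth_power)

lemma test_fun_sum:
  "(\<And>i. i \<in> I \<Longrightarrow> test_fun A (f i)) \<Longrightarrow> test_fun A (\<lambda>x. \<Sum>i\<in>I. f i x)"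
  by (simp add: test_fun_iff smooth_sum Cc_sum)

lemma test_fun_dderiv:
  assumes "test_fun A \<phi>" "b \<in> Basis"
  shows "test_fun A (dderiv [b] \<phi>)"
proof -
  have smooth: "smooth (dderiv [b] \<phi>)"
    by (rule smooth_dderiv[OF test_fun_smooth[OF assms(1)] assms(2)])
  obtain K where K: "compact K" "K \<subseteq> A" "\<And>x. x \<notin> K \<Longrightarrow> \<phi> x = 0"
    using CcE[OF test_fun_Cc[OF assms(1)]] by blast
  then have "dderiv [b] \<phi> \<in> Cc A"
    by (intro CcI[OF smooth_continuous_on[OF smooth] K(1,2)] dderiv_locally_const[of "- K" _ _ 0])
      (auto simp: compact_imp_closed)
  with smooth show ?thesis
    by (simp add: test_fun_iff)
qed

lemma smooth_product:
  fixes \<xi> :: "'a::euclidean_space \<Rightarrow> real" and \<theta> :: "'b::euclidean_space \<Rightarrow> real"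
  assumes "smooth \<xi>" "smooth \<theta>"
  shows "smooth (\<lambda>z. \<xi> (fst z) * \<theta> (snd z))"
  by (intro smooth_mult smooth_compose_bounded_linear[OF assms(1) bounded_linear_fst]
      smooth_compose_bounded_linear[OF assms(2) bounded_linear_snd])

lemma test_fun_product:
  "test_fun A \<xi> \<Longrightarrow> test_fun B \<theta> \<Longrightarrow> test_fun (A \<times> B) (\<lambda>z. \<xi> (fst z) * \<theta> (snd z))"
  by (simp add: test_fun_iff smooth_product Cc_product)

lemma dderiv_product:
  fixes \<xi> :: "'a::euclidean_space \<Rightarrow> real" and \<theta> :: "'b::euclidean_space \<Rightarrow> real"
  assumes "smooth \<xi>" "smooth \<theta>"
  shows "dderiv [(v, w)] (\<lambda>z. \<xi> (fst z) * \<theta> (snd z)) z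
    = \<xi> (fst z) * dderiv [w] \<theta> (snd z) + dderiv [v] \<xi> (fst z) * \<theta> (snd z)"
proof -
  have \<xi>: "((\<lambda>z. \<xi> (fst z)) has_derivative (\<lambda>v. dderiv [fst v] \<xi> (fst z))) (at z)"
    unfolding dderiv_singleton
    by (rule has_derivative_compose[OF has_derivative_fst[OF has_derivative_ident]])
      (simp add: frechet_derivative_works[symmetric] smooth_differentiable[OF assms(1)])
  have \<theta>: "((\<lambda>z. \<theta> (snd z)) has_derivative (\<lambda>v. dderiv [snd v] \<theta> (snd z))) (at z)"
    unfolding dderiv_singleton
    by (rule has_derivative_compose[OF has_derivative_snd[OF has_derivative_ident]])
      (simp add: frechet_derivative_works[symmetric] smooth_differentiable[OF assms(2)])
  show ?thesis
    using dderiv_eqI[OF has_derivative_mult[OF \<xi> \<theta>], of "(v, w)"] by simp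
qed

lemma dderiv_zero: "smooth f \<Longrightarrow> dderiv [0] f x = 0"
  using dderiv_eqI[OF smooth_has_derivative, of f 0 x] by simp

lemma test_fun_bump:
  fixes x0 :: "'a::euclidean_space"
  assumes "0 < r" "cball x0 r \<subseteq> A"
  obtains \<eta> where "test_fun A \<eta>" "\<And>x. 0 \<le> \<eta> x" "\<And>x. \<eta> x \<le> 1" "\<And>x. \<eta> x = 0 \<longleftrightarrow> x \<notin> ball x0 r"
proof -
  obtain \<eta> where \<eta>: "smooth \<eta>" "\<And>x. 0 \<le> \<eta> x" "\<And>x. \<eta> x \<le> 1" "\<And>x. \<eta> x = 0 \<longleftrightarrow> x \<notin> ball x0 r"
    using smooth_bump[OF assms(1), of x0] by metis
  have "\<eta> \<in> Cc A"
    by (rule CcI[OF smooth_continuous_on[OF \<eta>(1)] compact_cball assms(2)]) (simp add: \<eta>(4))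
  with \<eta> show ?thesis
    by (intro that[of \<eta>]) (simp_all add: test_fun_iff)
qed

lemma test_fun_cutoff:
  fixes R :: "'a::euclidean_space set"
  assumes "open R" "compact K" "K \<subseteq> R"
  obtains \<zeta> where "test_fun R \<zeta>" "\<And>x. 0 \<le> \<zeta> x" "\<And>x. x \<in> K \<Longrightarrow> 0 < \<zeta> x"
proof -
  have "\<exists>r \<eta>. 0 < r \<and> test_fun R \<eta> \<and> (\<forall>y. 0 \<le> \<eta> y) \<and> (\<forall>y\<in>ball x r. 0 < \<eta> y)"
    if x: "x \<in> K" for x
  proof -
    obtain r where r: "0 < r" "cball x r \<subseteq> R"
      using assms(1,3) x open_contains_cball by blast
    obtain \<eta> where "test_fun R \<eta>" "\<And>y. 0 \<le> \<eta> y" "\<And>y. \<eta> y = 0 \<longleftrightarrow> y \<notin> ball x r"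
      using test_fun_bump[OF r] by metis
    with r(1) show ?thesis
      by (intro exI[of _ r] exI[of _ \<eta>]) (auto simp: less_le)
  qed
  then obtain r \<eta> where r: "\<And>x. x \<in> K \<Longrightarrow> 0 < r x"
    and \<eta>: "\<And>x. x \<in> K \<Longrightarrow> test_fun R (\<eta> x)" "\<And>x y. x \<in> K \<Longrightarrow> 0 \<le> \<eta> x y"
      "\<And>x y. x \<in> K \<Longrightarrow> y \<in> ball x (r x) \<Longrightarrow> 0 < \<eta> x y"
    by metis
  have "K \<subseteq> (\<Union>x\<in>K. ball x (r x))"
    using r by force
  then obtain X where X: "X \<subseteq> K" "finite X" "K \<subseteq> (\<Union>x\<in>X. ball x (r x))"
    by (rule compactE_image[OF assms(2) open_ball])
  show ?thesis
  proof
    show "test_fun R (\<lambda>y. \<Sum>x\<in>X. \<eta> x y)"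
      using X(1) \<eta>(1) by (intro test_fun_sum) auto
    show "0 \<le> (\<Sum>x\<in>X. \<eta> x y)" for y
      using X(1) \<eta>(2) by (intro sum_nonneg) auto
    show "0 < (\<Sum>x\<in>X. \<eta> x y)" if y: "y \<in> K" for y
    proof -
      obtain x where "x \<in> X" "y \<in> ball x (r x)"
        using X(3) y by blast
      then show ?thesis
        using X(1,2) \<eta>(2,3) by (intro sum_pos2[of X x]) auto
    qed
  qed
qed

lemma Cc_cutoff:
  assumes "open R" "compact K" "K \<subseteq> R"
  obtains \<zeta> where "\<zeta> \<in> Cc R" "\<And>x. 0 \<le> \<zeta> x" "\<And>x. x \<in> K \<Longrightarrow> \<zeta> x = 1"
proof (cases "K = {}")
  case True
  then show ?thesis
    using that[OF Cc_zero] by auto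
next
  case False
  obtain \<zeta> where \<zeta>: "test_fun R \<zeta>" "\<And>x. 0 \<le> \<zeta> x" "\<And>x. x \<in> K \<Longrightarrow> 0 < \<zeta> x"
    using test_fun_cutoff[OF assms] by blast
  obtain y where y: "y \<in> K" "\<And>x. x \<in> K \<Longrightarrow> \<zeta> y \<le> \<zeta> x"
    using continuous_attains_inf[OF assms(2) False Cc_continuous_on[OF test_fun_Cc[OF \<zeta>(1)]]] by blast
  then have "0 < \<zeta> y"
    using \<zeta>(3) by blast
  show ?thesis
  proof
    show "(\<lambda>x. min (inverse (\<zeta> y) * \<zeta> x) 1) \<in> Cc R"
      by (intro Cc_min_const Cc_cmult test_fun_Cc[OF \<zeta>(1)]) simp
    show "0 \<le> min (inverse (\<zeta> y) * \<zeta> x) 1" for x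
      using \<zeta>(2) by simp
    show "min (inverse (\<zeta> y) * \<zeta> x) 1 = 1" if "x \<in> K" for x
      using y(2)[OF that] \<open>0 < \<zeta> y\<close> by (simp add: field_simps)
  qed
qed

lemma continuous_on_divide_cutoff:
  fixes \<psi> \<zeta> :: "'a::t2_space \<Rightarrow> real"
  assumes "compact K" "continuous_on UNIV \<psi>" "continuous_on UNIV \<zeta>"
    and "\<And>x. x \<notin> K \<Longrightarrow> \<psi> x = 0" "\<And>x. x \<in> K \<Longrightarrow> 0 < \<zeta> x"
  shows "continuous_on UNIV (\<lambda>x. \<psi> x / \<zeta> x)"
proof (rule continuous_on_extend_zero[of "{x. 0 < \<zeta> x}" _ K])
  show "open {x. 0 < \<zeta> x}"
    by (intro open_Collect_less continuous_on_const assms(3))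
  show "continuous_on {x. 0 < \<zeta> x} (\<lambda>x. \<psi> x / \<zeta> x)"
    using assms(2,3) by (intro continuous_on_divide) (auto intro: continuous_on_subset)
qed (use assms in \<open>auto simp: compact_imp_closed\<close>)

text \<open>Stone--Weierstrass for the quotient of \<open>\<psi>\<close> by a cutoff function that is positive on its support.\<close>
lemma test_fun_dense:
  fixes R :: "'a::euclidean_space set"
  assumes "open R" "\<psi> \<in> Cc R"
  obtains \<zeta> where "test_fun R \<zeta>"
    and "\<And>e. 0 < e \<Longrightarrow> \<exists>\<xi>. test_fun R \<xi> \<and> (\<forall>x. \<bar>\<psi> x - \<xi> x\<bar> \<le> e * \<zeta> x)"
proof -
  obtain K where K: "compact K" "K \<subseteq> R" "\<And>x. x \<notin> K \<Longrightarrow> \<psi> x = 0"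
    using CcE[OF assms(2)] by blast
  obtain \<zeta> where \<zeta>: "test_fun R \<zeta>" "\<And>x. 0 \<le> \<zeta> x" "\<And>x. x \<in> K \<Longrightarrow> 0 < \<zeta> x"
    using test_fun_cutoff[OF assms(1) K(1,2)] by blast
  obtain D where D: "compact D" "D \<subseteq> R" "\<And>x. x \<notin> D \<Longrightarrow> \<zeta> x = 0"
    using CcE[OF test_fun_Cc[OF \<zeta>(1)]] by blast
  let ?f = "\<lambda>x. \<psi> x / \<zeta> x"
  have f: "continuous_on UNIV ?f"
    by (rule continuous_on_divide_cutoff[OF K(1) Cc_continuous_on[OF assms(2)]
          Cc_continuous_on[OF test_fun_Cc[OF \<zeta>(1)]] K(3) \<zeta>(3)])
  have \<psi>: "\<psi> x = \<zeta> x * ?f x" for x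
    using K(3)[of x] \<zeta>(3)[of x] by (cases "x \<in> K") auto
  show ?thesis
  proof
    fix e :: real assume "0 < e"
    then obtain p where p: "real_polynomial_function p" "\<And>x. x \<in> D \<Longrightarrow> \<bar>?f x - p x\<bar> < e"
      using Stone_Weierstrass_real_polynomial_function[OF D(1) continuous_on_subset[OF f subset_UNIV]]
      by blast
    have "\<bar>\<psi> x - \<zeta> x * p x\<bar> \<le> e * \<zeta> x" for x
    proof (cases "x \<in> D")
      case True
      have "\<psi> x - \<zeta> x * p x = \<zeta> x * (?f x - p x)"
        by (simp only: right_diff_distrib \<psi>[symmetric])
      then have "\<bar>\<psi> x - \<zeta> x * p x\<bar> = \<bar>?f x - p x\<bar> * \<zeta> x"
        using \<zeta>(2)[of x] by (simp only: abs_mult abs_of_nonneg mult.commute)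
      also have "\<dots> \<le> e * \<zeta> x"
        using p(2)[OF True] \<zeta>(2) by (intro mult_right_mono) auto
      finally show ?thesis .
    next
      case False
      then show ?thesis
        using \<psi>[of x] D(3) by simp
    qed
    then show "\<exists>\<xi>. test_fun R \<xi> \<and> (\<forall>x. \<bar>\<psi> x - \<xi> x\<bar> \<le> e * \<zeta> x)"
      using test_fun_mult[OF \<zeta>(1) smooth_real_polynomial_function[OF p(1)]] by blast
  qed (rule \<zeta>(1))
qed

section \<open>The Riesz representation theorem\<close>

lemma real_le_if_le_add_mult:
  fixes a b c :: real
  assumes "\<And>\<epsilon>. 0 < \<epsilon> \<Longrightarrow> a \<le> b + \<epsilon> * c"
  shows "a \<le> b"
proof (rule tendsto_lowerbound)
  show "((\<lambda>\<epsilon>. b + \<epsilon> * c) \<longlongrightarrow> b) (at_right 0)"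
    by (auto intro!: tendsto_eq_intros)
  show "\<forall>\<^sub>F \<epsilon> in at_right 0. a \<le> b + \<epsilon> * c"
    using eventually_at_right_less by eventually_elim (rule assms)
qed simp

lemma compact_finite_domination:
  fixes f :: "'a::topological_space \<Rightarrow> real"
  assumes "compact K" "continuous_on UNIV f" "\<And>n. continuous_on UNIV (F n)" "\<And>n x. 0 \<le> F n x"
    and domination: "\<And>x. x \<in> K \<Longrightarrow> ennreal (f x) \<le> (\<Sum>n. ennreal (F n x))" and "0 < \<epsilon>"
  obtains N where "\<And>x. x \<in> K \<Longrightarrow> f x < (\<Sum>n<N. F n x) + \<epsilon>"
proof -
  define W where "W N = {x. f x < (\<Sum>n<N. F n x) + \<epsilon>}" for N
  have "open (W N)" for N
    unfolding W_def by (intro open_Collect_less continuous_intros assms)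
  have "(\<Sum>n<M. F n x) \<le> (\<Sum>n<N. F n x)" if "M \<le> N" for M N x
    by (intro sum_mono2) (use that assms(4) in auto)
  then have W_mono: "W M \<subseteq> W N" if "M \<le> N" for M N
    using that unfolding W_def by (smt (verit) Collect_mono)
  have "K \<subseteq> (\<Union>N. W N)"
  proof
    fix x assume "x \<in> K"
    show "x \<in> (\<Union>N. W N)"
    proof (rule ccontr)
      assume "x \<notin> (\<Union>N. W N)"
      then have partial_sums: "(\<Sum>n<N. F n x) \<le> f x - \<epsilon>" for N
        by (auto simp: W_def not_less le_diff_eq)
      then have "(\<Sum>n. ennreal (F n x)) \<le> ennreal (f x - \<epsilon>)"
        by (auto simp: suminf_eq_SUP assms(4) intro!: SUP_least ennreal_leI)
      also have "\<dots> < ennreal (f x)"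
        using partial_sums[of 0] \<open>0 < \<epsilon>\<close> by (intro ennreal_lessI) auto
      finally show False
        using domination[OF \<open>x \<in> K\<close>] by simp
    qed
  qed
  then obtain D where "finite D" "K \<subseteq> (\<Union>N\<in>D. W N)"
    by (rule compactE_image[OF assms(1) \<open>\<And>N. open (W N)\<close>])
  moreover from \<open>finite D\<close> have "W N \<subseteq> W (Max (insert 0 D))" if "N \<in> D" for N
    using that by (intro W_mono Max_ge) auto
  ultimately have "K \<subseteq> W (Max (insert 0 D))"
    by blast
  then show ?thesis
    by (intro that[of "Max (insert 0 D)"]) (auto simp: W_def)
qed

lemma open_indicator_approximation:
  fixes V :: "'a::metric_space set"
  assumes "open V"
  obtains g :: "nat \<Rightarrow> 'a \<Rightarrow> real"
  where "\<And>k. continuous_on UNIV (g k)" "\<And>k x. 0 \<le> g k x" "\<And>k x. g k x \<le> 1"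
    "\<And>k x. g k x \<le> g (Suc k) x" "\<And>x. g 0 x = 0"
    "\<And>x. x \<in> V \<Longrightarrow> \<exists>k. g k x = 1" "\<And>k x. x \<notin> V \<Longrightarrow> g k x = 0"
proof -
  define d where "d x = (if V = UNIV then 1 else infdist x (- V))" for x
  have d: "continuous_on UNIV d" "\<And>x. 0 \<le> d x" "\<And>x. x \<notin> V \<Longrightarrow> d x = 0"
    unfolding d_def
    by (cases "V = UNIV"; auto intro: infdist_nonneg continuous_on_infdist continuous_on_id)+
  have d_pos: "0 < d x" if "x \<in> V" for x
    using that d(2)[of x] in_closed_iff_infdist_zero[of "- V" x] assms
    by (auto simp: d_def less_le closed_Compl)
  show ?thesis
  proof (rule that[of "\<lambda>k x. min 1 (real k * d x)"])
    show "continuous_on UNIV (\<lambda>x. min 1 (real k * d x))" for k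
      by (intro continuous_intros d(1))
    show "min 1 (real k * d x) \<le> min 1 (real (Suc k) * d x)" for k x
      using d(2) by (intro min.mono mult_right_mono) auto
    show "\<exists>k. min 1 (real k * d x) = 1" if "x \<in> V" for x
      using reals_Archimedean3[OF d_pos[OF that]] by (metis less_imp_le min.absorb1)
  qed (auto simp: d)
qed

locale positive_functional =
  fixes R :: "'a::euclidean_space set" and L :: "('a \<Rightarrow> real) \<Rightarrow> real"
  assumes open_R: "open R"
    and L_add: "f \<in> Cc R \<Longrightarrow> h \<in> Cc R \<Longrightarrow> L (\<lambda>x. f x + h x) = L f + L h"
    and L_cmult: "f \<in> Cc R \<Longrightarrow> L (\<lambda>x. c * f x) = c * L f"
    and L_nonneg: "f \<in> Cc R \<Longrightarrow> (\<And>x. 0 \<le> f x) \<Longrightarrow> 0 \<le> L f"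
begin

lemma L_zero: "L (\<lambda>_. 0) = 0"
  using L_cmult[OF Cc_zero, of 0] by simp

lemma L_diff: "f \<in> Cc R \<Longrightarrow> h \<in> Cc R \<Longrightarrow> L (\<lambda>x. f x - h x) = L f - L h"
  using L_add[of f "\<lambda>x. -1 * h x"] Cc_cmult[of h R "-1"] L_cmult[of h "-1"] by simp

lemma L_mono: "f \<in> Cc R \<Longrightarrow> h \<in> Cc R \<Longrightarrow> (\<And>x. f x \<le> h x) \<Longrightarrow> L f \<le> L h"
  using L_nonneg[of "\<lambda>x. h x - f x"] L_diff[of h f] Cc_diff[of h R f] by auto

lemma L_sum: "(\<And>i. i \<in> I \<Longrightarrow> f i \<in> Cc R) \<Longrightarrow> L (\<lambda>x. \<Sum>i\<in>I. f i x) = (\<Sum>i\<in>I. L (f i))"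
  by (induction I rule: infinite_finite_induct) (auto simp: L_zero intro!: L_add[THEN trans] Cc_sum)

lemma abs_L_diff_le:
  assumes "f \<in> Cc R" "h \<in> Cc R" "\<zeta> \<in> Cc R" "\<And>x. \<bar>f x - h x\<bar> \<le> e * \<zeta> x"
  shows "\<bar>L f - L h\<bar> \<le> e * L \<zeta>"
proof -
  have bounds: "f x - h x \<le> e * \<zeta> x" "h x - f x \<le> e * \<zeta> x" for x
    using assms(4)[of x] by linarith+
  have "L (\<lambda>x. f x - h x) \<le> L (\<lambda>x. e * \<zeta> x)" "L (\<lambda>x. h x - f x) \<le> L (\<lambda>x. e * \<zeta> x)"
    by (intro L_mono Cc_diff Cc_cmult assms bounds)+
  then show ?thesis
    using assms by (simp add: L_diff L_cmult)
qed

lemma L_le_sum_add: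
  assumes f: "f \<in> Cc R" and F: "\<And>n. F n \<in> Cc R" "\<And>n x. 0 \<le> F n x"
    and \<zeta>: "\<zeta> \<in> Cc R" "\<And>x. 0 \<le> \<zeta> x" "\<And>x. x \<in> K \<Longrightarrow> \<zeta> x = 1"
    and "0 < \<epsilon>" "\<And>x. x \<notin> K \<Longrightarrow> f x = 0" "\<And>x. x \<in> K \<Longrightarrow> f x < (\<Sum>n<N. F n x) + \<epsilon>"
  shows "L f \<le> (\<Sum>n<N. L (F n)) + \<epsilon> * L \<zeta>"
proof -
  have "f x \<le> (\<Sum>n<N. F n x) + \<epsilon> * \<zeta> x" for x
  proof (cases "x \<in> K")
    case False
    then show ?thesis
      using assms(8) F(2) \<zeta>(2)[of x] \<open>0 < \<epsilon>\<close> by (simp add: sum_nonneg)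
  qed (use assms(9) \<zeta>(3) in \<open>auto intro: less_imp_le\<close>)
  then have "L f \<le> L (\<lambda>x. (\<Sum>n<N. F n x) + \<epsilon> * \<zeta> x)"
    by (intro L_mono f Cc_add Cc_sum Cc_cmult F(1) \<zeta>(1))
  also have "\<dots> = (\<Sum>n<N. L (F n)) + \<epsilon> * L \<zeta>"
    using F(1) \<zeta>(1) by (simp add: L_add L_sum L_cmult Cc_sum Cc_cmult)
  finally show ?thesis .
qed

lemma L_le_suminf:
  assumes f: "f \<in> Cc R" "\<And>x. 0 \<le> f x"
    and F: "\<And>n. F n \<in> Cc R" "\<And>n x. 0 \<le> F n x"
    and domination: "\<And>x. x \<in> R \<Longrightarrow> ennreal (f x) \<le> (\<Sum>n. ennreal (F n x))"
  shows "ennreal (L f) \<le> (\<Sum>n. ennreal (L (F n)))"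
proof (cases "(\<Sum>n. ennreal (L (F n)))" rule: ennreal_cases)
  case (real b)
  obtain K where K: "compact K" "K \<subseteq> R" "\<And>x. x \<notin> K \<Longrightarrow> f x = 0"
    using CcE[OF f(1)] by blast
  obtain \<zeta> where \<zeta>: "\<zeta> \<in> Cc R" "\<And>x. 0 \<le> \<zeta> x" "\<And>x. x \<in> K \<Longrightarrow> \<zeta> x = 1"
    using Cc_cutoff[OF open_R K(1,2)] by blast
  have "L f \<le> b + \<epsilon> * L \<zeta>" if \<epsilon>: "0 < \<epsilon>" for \<epsilon>
  proof -
    obtain N where N: "\<And>x. x \<in> K \<Longrightarrow> f x < (\<Sum>n<N. F n x) + \<epsilon>"
      by (rule compact_finite_domination[OF K(1) Cc_continuous_on[OF f(1)] Cc_continuous_on[OF F(1)] F(2)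
          domination \<epsilon>]) (use K(2) in auto)
    have "L f \<le> (\<Sum>n<N. L (F n)) + \<epsilon> * L \<zeta>"
      by (rule L_le_sum_add[OF f(1) F \<zeta> \<epsilon> K(3) N])
    also have "(\<Sum>n<N. L (F n)) \<le> b"
    proof -
      have "ennreal (\<Sum>n<N. L (F n)) = (\<Sum>n<N. ennreal (L (F n)))"
        using L_nonneg[OF F] by simp
      also have "\<dots> \<le> ennreal b"
        unfolding real(2)[symmetric] by (intro sum_le_suminf) auto
      finally show ?thesis
        using real(1) by simp
    qed
    finally show ?thesis
      by simp
  qed
  then have "L f \<le> b"
    by (rule real_le_if_le_add_mult)
  then show ?thesis
    by (simp add: real ennreal_leI)
qed simp

text \<open>
  The upper integral. Majorizing by series of continuous functions rather than covering by open sets makes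
  countable subadditivity immediate; only values on \<open>R\<close> count, so the complement of \<open>R\<close> is null.
\<close>
definition majorants :: "('a \<Rightarrow> ennreal) \<Rightarrow> (nat \<Rightarrow> 'a \<Rightarrow> real) set" where
  "majorants h = {F. (\<forall>n. F n \<in> Cc R \<and> (\<forall>x. 0 \<le> F n x)) \<and> (\<forall>x\<in>R. h x \<le> (\<Sum>n. ennreal (F n x)))}"

definition upper :: "('a \<Rightarrow> ennreal) \<Rightarrow> ennreal" where
  "upper h = (INF F\<in>majorants h. \<Sum>n. ennreal (L (F n)))"

lemma upper_le: "F \<in> majorants h \<Longrightarrow> upper h \<le> (\<Sum>n. ennreal (L (F n)))"
  unfolding upper_def by (rule INF_lower)

lemma upper_mono:
  assumes "\<And>x. x \<in> R \<Longrightarrow> h x \<le> h' x"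
  shows "upper h \<le> upper h'"
  unfolding upper_def majorants_def
  by (rule INF_superset_mono) (auto intro: order_trans[OF assms])

lemma upper_le_L:
  assumes "f \<in> Cc R" "\<And>x. 0 \<le> f x" "\<And>x. x \<in> R \<Longrightarrow> h x \<le> ennreal (f x)"
  shows "upper h \<le> ennreal (L f)"
proof -
  define F where "F n = (if n = 0 then f else (\<lambda>_. 0))" for n :: nat
  have suminf_F: "(\<Sum>n. \<Phi> (F n)) = \<Phi> f" if "\<Phi> (\<lambda>_. 0) = 0" for \<Phi> :: "('a \<Rightarrow> real) \<Rightarrow> ennreal"
    using suminf_finite[of "{0}" "\<lambda>n. \<Phi> (F n)"] that by (simp add: F_def)
  have "F n \<in> Cc R" "0 \<le> F n x" for n x
    using assms(1,2) by (auto simp: F_def Cc_zero)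
  moreover have "h x \<le> (\<Sum>n. ennreal (F n x))" if "x \<in> R" for x
    using suminf_F[of "\<lambda>f. ennreal (f x)"] assms(3)[OF that] by simp
  ultimately have "F \<in> majorants h"
    by (simp add: majorants_def)
  from upper_le[OF this] show ?thesis
    using suminf_F[of "\<lambda>f. ennreal (L f)"] by (simp add: L_zero)
qed

lemma L_le_upper:
  assumes "f \<in> Cc R" "\<And>x. 0 \<le> f x" "\<And>x. ennreal (f x) \<le> h x"
  shows "ennreal (L f) \<le> upper h"
  unfolding upper_def
proof (rule INF_greatest)
  fix F assume "F \<in> majorants h"
  then show "ennreal (L f) \<le> (\<Sum>n. ennreal (L (F n)))"
    using assms(1,2) by (intro L_le_suminf) (auto simp: majorants_def intro: order_trans[OF assms(3)])
qed

lemma upper_zero: "upper (\<lambda>_. 0) = 0"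
  using upper_le_L[OF Cc_zero, of "\<lambda>_. 0"] by (simp add: L_zero)

lemma upper_suminf: "upper (\<lambda>x. \<Sum>n. h n x) \<le> (\<Sum>n. upper (h n))"
proof (rule ennreal_le_epsilon)
  fix e :: real assume "0 < e" and finite: "(\<Sum>n. upper (h n)) < top"
  have "\<exists>F\<in>majorants (h n). (\<Sum>i. ennreal (L (F i))) \<le> upper (h n) + ennreal (e * (1/2) ^ Suc n)" for n
  proof -
    have "upper (h n) < upper (h n) + ennreal (e * (1/2) ^ Suc n)"
      using finite \<open>0 < e\<close> by (auto simp: less_top dest!: ennreal_suminf_lessD)
    then show ?thesis
      by (subst (asm) upper_def) (auto simp: INF_less_iff intro: less_imp_le)
  qed
  then obtain F where F: "\<And>n. F n \<in> majorants (h n)"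
    "\<And>n. (\<Sum>i. ennreal (L (F n i))) \<le> upper (h n) + ennreal (e * (1/2) ^ Suc n)"
    by metis
  define G where "G i = case_prod F (prod_decode i)" for i
  have suminf_G: "(\<Sum>i. \<Phi> (G i)) = (\<Sum>n. \<Sum>i. \<Phi> (F n i))" for \<Phi> :: "('a \<Rightarrow> real) \<Rightarrow> ennreal"
    unfolding G_def
    by (subst suminf_ennreal_2dimen[of "\<lambda>n. \<Sum>i. \<Phi> (F n i)" "\<lambda>p. \<Phi> (case_prod F p)", symmetric]) simp_all
  have "(\<Sum>n. h n x) \<le> (\<Sum>i. ennreal (G i x))" if "x \<in> R" for x
    using F(1) that suminf_G[of "\<lambda>f. ennreal (f x)"] by (auto simp: majorants_def intro!: suminf_le)
  then have "G \<in> majorants (\<lambda>x. \<Sum>n. h n x)"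
    using F(1) by (auto simp: majorants_def G_def split: prod.split)
  then have "upper (\<lambda>x. \<Sum>n. h n x) \<le> (\<Sum>n. \<Sum>i. ennreal (L (F n i)))"
    using upper_le suminf_G[of "\<lambda>f. ennreal (L f)"] by metis
  also have "\<dots> \<le> (\<Sum>n. upper (h n) + ennreal (e * (1/2) ^ Suc n))"
    by (intro suminf_le F(2)) auto
  also have "\<dots> = (\<Sum>n. upper (h n)) + (\<Sum>n. ennreal e * ennreal ((1/2) ^ Suc n))"
    using \<open>0 < e\<close> by (subst suminf_add[symmetric])
      (auto simp del: ennreal_suminf_cmult simp add: ennreal_mult[symmetric])
  also have "\<dots> = (\<Sum>n. upper (h n)) + ennreal e"
    unfolding ennreal_suminf_cmult
    by (subst suminf_ennreal_eq[OF zero_le_power power_half_series]) auto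
  finally show "upper (\<lambda>x. \<Sum>n. h n x) \<le> (\<Sum>n. upper (h n)) + ennreal e" .
qed

text \<open>The increments \<open>f (g (j + 1) - g j)\<close> majorize \<open>f\<close> on \<open>V\<close>.\<close>
lemma upper_le_SUP:
  assumes f: "f \<in> Cc R" "\<And>x. 0 \<le> f x"
    and g: "\<And>k. continuous_on UNIV (g k)" "\<And>k x. g k x \<le> g (Suc k) x" "\<And>x. g 0 x = 0"
    and g_eventually_1: "\<And>x. x \<in> V \<Longrightarrow> \<exists>k::nat. g k x = 1"
  shows "upper (\<lambda>x. ennreal (f x) * indicator V x) \<le> (SUP k. ennreal (L (\<lambda>x. f x * g k x)))"
proof -
  define D where "D j x = f x * (g (Suc j) x - g j x)" for j x
  have D: "D j \<in> Cc R" "0 \<le> D j x" for j x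
    unfolding D_def using f g by (auto intro!: Cc_mult continuous_on_diff)
  have D_telescope: "(\<Sum>j<k. D j x) = f x * g k x" for k x
    unfolding D_def sum_distrib_left[symmetric] sum_lessThan_telescope[of "\<lambda>j. g j x"] by (simp add: g(3))
  have "ennreal (f x) * indicator V x \<le> (\<Sum>j. ennreal (D j x))" for x
  proof (cases "x \<in> V")
    case True
    then obtain k where "g k x = 1"
      using g_eventually_1 by blast
    then have "ennreal (f x) = (\<Sum>j<k. ennreal (D j x))"
      using D_telescope[of x k] D(2) by simp
    also have "\<dots> \<le> (\<Sum>j. ennreal (D j x))"
      by (intro sum_le_suminf) auto
    finally show ?thesis
      using True by simp
  qed simp
  then have "D \<in> majorants (\<lambda>x. ennreal (f x) * indicator V x)"
    using D by (simp add: majorants_def)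
  then have "upper (\<lambda>x. ennreal (f x) * indicator V x) \<le> (SUP k. \<Sum>j<k. ennreal (L (D j)))"
    using upper_le by (simp add: suminf_eq_SUP)
  moreover have "(\<Sum>j<k. ennreal (L (D j))) = ennreal (L (\<lambda>x. f x * g k x))" for k
    using L_sum[of "{..<k}" D, OF D(1)] L_nonneg[OF D] by (simp add: D_telescope)
  ultimately show ?thesis
    by simp
qed

lemma upper_split_Cc:
  assumes "open V" and f: "f \<in> Cc R" "\<And>x. 0 \<le> f x"
  shows "upper (\<lambda>x. ennreal (f x) * indicator V x) + upper (\<lambda>x. ennreal (f x) * indicator (- V) x)
    \<le> ennreal (L f)"
proof -
  obtain g :: "nat \<Rightarrow> 'a \<Rightarrow> real" where g: "\<And>k. continuous_on UNIV (g k)"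
      "\<And>k x. 0 \<le> g k x" "\<And>k x. g k x \<le> 1" "\<And>k x. g k x \<le> g (Suc k) x" "\<And>x. g 0 x = 0"
      "\<And>x. x \<in> V \<Longrightarrow> \<exists>k. g k x = 1" and g_outside: "\<And>k x. x \<notin> V \<Longrightarrow> g k x = 0"
    using open_indicator_approximation[OF assms(1)] by metis
  have parts: "(\<lambda>x. f x * g k x) \<in> Cc R" "(\<lambda>x. f x * (1 - g k x)) \<in> Cc R"
      "0 \<le> f x * g k x" "0 \<le> f x * (1 - g k x)" for k x
    using f g by (auto intro!: Cc_mult continuous_on_diff continuous_on_const)
  have "upper (\<lambda>x. ennreal (f x) * indicator V x) + upper (\<lambda>x. ennreal (f x) * indicator (- V) x)
      \<le> (SUP k. ennreal (L (\<lambda>x. f x * g k x)) + upper (\<lambda>x. ennreal (f x) * indicator (- V) x))"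
    using upper_le_SUP[OF f g(1,4-6)] by (subst ennreal_SUP_add_left) (auto intro: add_right_mono)
  also have "\<dots> \<le> ennreal (L f)"
  proof (rule SUP_least)
    fix k
    have "upper (\<lambda>x. ennreal (f x) * indicator (- V) x) \<le> ennreal (L (\<lambda>x. f x * (1 - g k x)))"
      by (rule upper_le_L[OF parts(2,4)]) (auto simp: g_outside indicator_def)
    then have "ennreal (L (\<lambda>x. f x * g k x)) + upper (\<lambda>x. ennreal (f x) * indicator (- V) x)
        \<le> ennreal (L (\<lambda>x. f x * g k x)) + ennreal (L (\<lambda>x. f x * (1 - g k x)))"
      by (rule add_left_mono)
    also have "\<dots> = ennreal (L (\<lambda>x. f x * g k x + f x * (1 - g k x)))"
      using L_nonneg[OF parts(1,3)] L_nonneg[OF parts(2,4)] parts(1,2) by (simp add: L_add)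
    finally show "ennreal (L (\<lambda>x. f x * g k x)) + upper (\<lambda>x. ennreal (f x) * indicator (- V) x)
        \<le> ennreal (L f)"
      by (simp add: algebra_simps)
  qed
  finally show ?thesis .
qed

lemma upper_split:
  assumes "open V"
  shows "upper (\<lambda>x. h x * indicator V x) + upper (\<lambda>x. h x * indicator (- V) x) \<le> upper h"
  unfolding upper_def[of h]
proof (rule INF_greatest)
  fix F assume "F \<in> majorants h"
  then have F: "\<And>n. F n \<in> Cc R" "\<And>n x. 0 \<le> F n x" "\<And>x. x \<in> R \<Longrightarrow> h x \<le> (\<Sum>n. ennreal (F n x))"
    by (auto simp: majorants_def)
  have restrict: "upper (\<lambda>x. h x * indicator A x)
      \<le> (\<Sum>n. upper (\<lambda>x. ennreal (F n x) * indicator A x))" for A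
  proof -
    have "upper (\<lambda>x. h x * indicator A x) \<le> upper (\<lambda>x. \<Sum>n. ennreal (F n x) * indicator A x)"
      by (intro upper_mono) (auto simp: indicator_def F(3))
    also have "\<dots> \<le> (\<Sum>n. upper (\<lambda>x. ennreal (F n x) * indicator A x))"
      by (rule upper_suminf)
    finally show ?thesis .
  qed
  have "upper (\<lambda>x. h x * indicator V x) + upper (\<lambda>x. h x * indicator (- V) x)
      \<le> (\<Sum>n. upper (\<lambda>x. ennreal (F n x) * indicator V x) + upper (\<lambda>x. ennreal (F n x) * indicator (- V) x))"
    by (subst suminf_add[symmetric]) (auto intro!: add_mono restrict)
  also have "\<dots> \<le> (\<Sum>n. ennreal (L (F n)))"
    by (intro suminf_le upper_split_Cc assms F) auto
  finally show "upper (\<lambda>x. h x * indicator V x) + upper (\<lambda>x. h x * indicator (- V) x)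
      \<le> (\<Sum>n. ennreal (L (F n)))" .
qed

definition riesz_measure :: "'a measure" where
  "riesz_measure = measure_of UNIV (sets borel) (\<lambda>A. upper (indicator A))"

lemma sets_riesz_measure: "sets riesz_measure = sets borel"
  unfolding riesz_measure_def using sets.sigma_sets_eq[of "borel :: 'a measure"] by simp

lemma outer_measure_upper: "outer_measure_space (Pow UNIV) (\<lambda>A. upper (indicator A))"
  unfolding outer_measure_space_def positive_def increasing_def countably_subadditive_def
proof (intro conjI allI impI ballI)
  show "upper (indicator {}) = 0"
    by (simp add: indicator_def[abs_def] upper_zero)
  show "upper (indicator A) \<le> upper (indicator B)" if "A \<subseteq> B" for A B
    using that by (intro upper_mono) (auto split: split_indicator)
  show "upper (indicator (\<Union>n. A n)) \<le> (\<Sum>n. upper (indicator (A n)))"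
    if "disjoint_family A" for A :: "nat \<Rightarrow> 'a set"
    using upper_suminf[of "\<lambda>n. indicator (A n)"] by (simp add: suminf_indicator[OF that, abs_def])
qed

lemma open_in_lambda_system:
  assumes "open V"
  shows "V \<in> lambda_system UNIV (Pow UNIV) (\<lambda>A. upper (indicator A))"
proof -
  have "upper (indicator (V \<inter> A)) + upper (indicator ((UNIV - V) \<inter> A)) = upper (indicator A)" for A
  proof (rule antisym)
    show "upper (indicator (V \<inter> A)) + upper (indicator ((UNIV - V) \<inter> A)) \<le> upper (indicator A)"
      using upper_split[OF assms, of "indicator A"]
      by (simp add: indicator_inter_arith[symmetric] Int_commute Compl_eq_Diff_UNIV)
    have "subadditive (Pow UNIV) (\<lambda>A. upper (indicator A))"
      using outer_measure_upper
      by (intro ring_of_sets.countably_subadditive_subadditive[OF ring_of_sets_Pow])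
        (simp_all only: outer_measure_space_def)
    from subadditiveD[OF this, of "V \<inter> A" "(UNIV - V) \<inter> A"]
    have "upper (indicator ((V \<inter> A) \<union> ((UNIV - V) \<inter> A)))
        \<le> upper (indicator (V \<inter> A)) + upper (indicator ((UNIV - V) \<inter> A))"
      by auto
    moreover have "(V \<inter> A) \<union> ((UNIV - V) \<inter> A) = A"
      by blast
    ultimately show "upper (indicator A) \<le> upper (indicator (V \<inter> A)) + upper (indicator ((UNIV - V) \<inter> A))"
      by simp
  qed
  then show ?thesis
    by (simp add: lambda_system_def)
qed

lemma emeasure_riesz_measure:
  assumes "A \<in> sets borel"
  shows "emeasure riesz_measure A = upper (indicator A)"
proof -
  let ?\<Lambda> = "lambda_system UNIV (Pow UNIV) (\<lambda>A. upper (indicator A))"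
  have measure: "measure_space UNIV ?\<Lambda> (\<lambda>A. upper (indicator A))"
    by (rule sigma_algebra.caratheodory_lemma[OF sigma_algebra_Pow outer_measure_upper])
  then have "sigma_algebra UNIV ?\<Lambda>"
    by (simp add: measure_space_def)
  then have "sets borel \<subseteq> ?\<Lambda>"
    unfolding borel_def
    using sigma_algebra.sigma_sets_subset[of UNIV ?\<Lambda> "Collect open"] open_in_lambda_system
    by (simp add: sets_measure_of_conv subset_iff)
  then have "measure_space UNIV (sets borel) (\<lambda>A. upper (indicator A))"
    using measure_down[OF measure] sets.sigma_algebra_axioms[of "borel :: 'a measure"] by simp
  then show ?thesis
    unfolding riesz_measure_def
    using assms by (intro emeasure_measure_of_sigma) (auto simp: measure_space_def)
qed

lemma L_le_riesz_measure:
  assumes "f \<in> Cc R" "\<And>x. 0 \<le> f x" "\<And>x. f x \<le> 1"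
  shows "ennreal (L f) \<le> emeasure riesz_measure {x. 0 < f x}"
proof -
  have "open {x. 0 < f x}"
    by (intro open_Collect_less continuous_on_const Cc_continuous_on[OF assms(1)])
  moreover have "ennreal (f x) \<le> indicator {x. 0 < f x} x" for x
    using assms(2,3) by (auto simp: indicator_def ennreal_le_1 not_less ennreal_neg)
  ultimately show ?thesis
    using L_le_upper[OF assms(1,2)] by (simp add: emeasure_riesz_measure borel_open)
qed

lemma riesz_measure_le_L:
  assumes "f \<in> Cc R" "\<And>x. 0 \<le> f x" "A \<in> sets borel" "\<And>x. x \<in> A \<inter> R \<Longrightarrow> 1 \<le> f x"
  shows "emeasure riesz_measure A \<le> ennreal (L f)"
  unfolding emeasure_riesz_measure[OF assms(3)]
  using assms by (intro upper_le_L) (auto simp: indicator_def ennreal_ge_1)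

lemma radon_riesz_measure: "radon_pos_on R riesz_measure"
  unfolding radon_pos_on_def
proof (intro conjI allI impI)
  show "sets riesz_measure = sets borel"
    by (rule sets_riesz_measure)
  have "emeasure riesz_measure (UNIV - R) \<le> ennreal (L (\<lambda>_. 0))"
    using open_R by (intro riesz_measure_le_L Cc_zero) auto
  then show "emeasure riesz_measure (UNIV - R) = 0"
    by (simp add: L_zero)
next
  fix K assume K: "compact K \<and> K \<subseteq> R"
  then obtain \<zeta> where "\<zeta> \<in> Cc R" "\<And>x. 0 \<le> \<zeta> x" "\<And>x. x \<in> K \<Longrightarrow> \<zeta> x = 1"
    using Cc_cutoff[OF open_R] by blast
  then have "emeasure riesz_measure K \<le> ennreal (L \<zeta>)"
    using K by (intro riesz_measure_le_L borel_compact) auto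
  then show "emeasure riesz_measure K < \<infinity>"
    by (simp add: le_less_trans)
qed

end

lemma integrable_Cc:
  assumes "radon_pos_on R \<mu>" "f \<in> Cc R"
  shows "integrable \<mu> f"
proof -
  have sets: "sets \<mu> = sets borel"
    using assms(1) by (simp add: radon_pos_on_def)
  obtain K where K: "compact K" "K \<subseteq> R" "\<And>x. x \<notin> K \<Longrightarrow> f x = 0"
    using CcE[OF assms(2)] by blast
  obtain B where B: "0 < B" "\<And>x. \<bar>f x\<bar> \<le> B"
    using Cc_bounded[OF assms(2)] by blast
  show ?thesis
  proof (rule Bochner_Integration.integrable_bound)
    show "integrable \<mu> (\<lambda>x. indicator K x *\<^sub>R B)"
      using assms(1) K by (auto simp: radon_pos_on_def sets intro!: integrable_real_indicator borel_compact)
    show "f \<in> borel_measurable \<mu>"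
      using borel_measurable_continuous_onI[OF Cc_continuous_on[OF assms(2)]]
        measurable_cong_sets[OF sets refl] by blast
    show "AE x in \<mu>. norm (f x) \<le> norm (indicator K x *\<^sub>R B)"
      using B K(3) by (auto simp: indicator_def)
  qed
qed

lemma positive_functional_integral:
  assumes "open R" "radon_pos_on R \<mu>"
  shows "positive_functional R (integral\<^sup>L \<mu>)"
proof
  show "(LINT x|\<mu>. f x + h x) = integral\<^sup>L \<mu> f + integral\<^sup>L \<mu> h" if "f \<in> Cc R" "h \<in> Cc R" for f h
    using that by (intro Bochner_Integration.integral_add integrable_Cc[OF assms(2)])
qed (use assms in \<open>auto intro!: integral_nonneg\<close>)

text \<open>The part of \<open>f\<close> between the heights \<open>k \<epsilon>\<close> and \<open>(k + 1) \<epsilon>\<close>, rescaled to take values in \<open>[0, 1]\<close>.\<close>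
definition layer :: "real \<Rightarrow> ('a \<Rightarrow> real) \<Rightarrow> nat \<Rightarrow> 'a \<Rightarrow> real" where
  "layer \<epsilon> f k x = (1 / \<epsilon>) * (min (f x) (real (Suc k) * \<epsilon>) - min (f x) (real k * \<epsilon>))"

lemma layer_Cc: "f \<in> Cc R \<Longrightarrow> 0 < \<epsilon> \<Longrightarrow> layer \<epsilon> f k \<in> Cc R"
  unfolding layer_def[abs_def] by (intro Cc_cmult Cc_diff Cc_min_const) auto

lemma layer_nonneg: "0 < \<epsilon> \<Longrightarrow> 0 \<le> layer \<epsilon> f k x"
  and layer_le_1: "0 < \<epsilon> \<Longrightarrow> layer \<epsilon> f k x \<le> 1"
  by (auto simp: layer_def min_def field_simps)

lemma layer_pos_iff: "0 < \<epsilon> \<Longrightarrow> 0 < layer \<epsilon> f k x \<longleftrightarrow> real k * \<epsilon> < f x"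
  by (auto simp: layer_def min_def field_simps)

lemma layer_eq_1: "0 < \<epsilon> \<Longrightarrow> real (Suc k) * \<epsilon> \<le> f x \<Longrightarrow> layer \<epsilon> f k x = 1"
  by (auto simp: layer_def min_def field_simps)

lemma sum_layers:
  assumes "0 < \<epsilon>" "0 \<le> f x" "f x \<le> real N * \<epsilon>"
  shows "(\<Sum>k<N. \<epsilon> * layer \<epsilon> f k x) = f x"
proof -
  have "(\<Sum>k<N. \<epsilon> * layer \<epsilon> f k x) = (\<Sum>k<N. min (f x) (real (Suc k) * \<epsilon>) - min (f x) (real k * \<epsilon>))"
    using assms(1) by (simp add: layer_def)
  also have "\<dots> = min (f x) (real N * \<epsilon>) - min (f x) (real 0 * \<epsilon>)"
    by (rule sum_lessThan_telescope)
  finally show ?thesis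
    using assms(2,3) by simp
qed

lemma positive_functional_sum_layers:
  assumes "positive_functional R L" "f \<in> Cc R" "0 < \<epsilon>" "\<And>x. 0 \<le> f x" "\<And>x. f x \<le> real N * \<epsilon>"
  shows "L f = \<epsilon> * (\<Sum>k<N. L (layer \<epsilon> f k))"
proof -
  interpret positive_functional R L
    by (rule assms(1))
  have "L f = L (\<lambda>x. \<Sum>k<N. \<epsilon> * layer \<epsilon> f k x)"
    using assms(3-5) by (simp add: sum_layers)
  also have "\<dots> = (\<Sum>k<N. L (\<lambda>x. \<epsilon> * layer \<epsilon> f k x))"
    by (intro L_sum Cc_cmult layer_Cc assms(2,3))
  finally show ?thesis
    using assms(2,3) by (simp add: L_cmult layer_Cc sum_distrib_left)
qed

definition level_set_bounds :: "'a::euclidean_space set \<Rightarrow> 'a measure \<Rightarrow> (('a \<Rightarrow> real) \<Rightarrow> real) \<Rightarrow> bool" where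
  "level_set_bounds R \<mu> L \<longleftrightarrow> (\<forall>f\<in>Cc R. (\<forall>x. 0 \<le> f x) \<longrightarrow>
    ((\<forall>x. f x \<le> 1) \<longrightarrow> ennreal (L f) \<le> emeasure \<mu> {x. 0 < f x}) \<and>
    (\<forall>A. open A \<and> (\<forall>x\<in>A. 1 \<le> f x) \<longrightarrow> emeasure \<mu> A \<le> ennreal (L f)))"

lemma level_set_bounds_le_if_dominated:
  assumes "level_set_bounds R \<mu> I" and J: "positive_functional R J" "level_set_bounds R \<mu> J"
    and h: "h \<in> Cc R" "\<And>x. 0 \<le> h x" "\<And>x. h x \<le> 1"
    and h': "h' \<in> Cc R" "\<And>x. 0 \<le> h' x" "\<And>x. 0 < h x \<Longrightarrow> 1 \<le> h' x"
  shows "I h \<le> J h'"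
proof -
  have "open {x. 0 < h x}"
    by (intro open_Collect_less continuous_on_const Cc_continuous_on[OF h(1)])
  have "ennreal (I h) \<le> emeasure \<mu> {x. 0 < h x}"
    using assms(1) h by (simp add: level_set_bounds_def)
  also have "\<dots> \<le> ennreal (J h')"
    using J(2) h' \<open>open {x. 0 < h x}\<close> by (simp add: level_set_bounds_def)
  finally show ?thesis
    using positive_functional.L_nonneg[OF J(1) h'(1,2)] by simp
qed

text \<open>The layer \<open>k + 1\<close> of \<open>f\<close> is supported where the layer \<open>k\<close> equals 1.\<close>
lemma level_set_bounds_le:
  assumes "positive_functional R I" "level_set_bounds R \<mu> I"
    and "positive_functional R J" "level_set_bounds R \<mu> J"
    and f: "f \<in> Cc R" "\<And>x. 0 \<le> f x"
  shows "I f \<le> J f"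
proof -
  note dominate = level_set_bounds_le_if_dominated[OF assms(2-4)]
  obtain K where K: "compact K" "K \<subseteq> R" "\<And>x. x \<notin> K \<Longrightarrow> f x = 0"
    using CcE[OF f(1)] by blast
  obtain \<zeta> where \<zeta>: "\<zeta> \<in> Cc R" "\<And>x. 0 \<le> \<zeta> x" "\<And>x. x \<in> K \<Longrightarrow> \<zeta> x = 1"
    using Cc_cutoff[OF positive_functional.open_R[OF assms(1)] K(1,2)] by blast
  obtain B where B: "0 < B" "\<And>x. \<bar>f x\<bar> \<le> B"
    using Cc_bounded[OF f(1)] by blast
  have "I f \<le> J f + \<epsilon> * J \<zeta>" if \<epsilon>: "0 < \<epsilon>" for \<epsilon>
  proof -
    obtain N :: nat where "B < real N * \<epsilon>"
      using reals_Archimedean3[OF \<epsilon>] by blast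
    then have N: "f x \<le> real N * \<epsilon>" "f x \<le> real (Suc N) * \<epsilon>" for x
      using B(2)[of x] \<epsilon> by (auto simp: algebra_simps abs_le_iff)
    note layers = layer_Cc[OF f(1) \<epsilon>] layer_nonneg[OF \<epsilon>] layer_le_1[OF \<epsilon>]
    have "I (layer \<epsilon> f 0) \<le> J \<zeta>"
    proof (rule dominate[OF layers \<zeta>(1,2)])
      fix x assume "0 < layer \<epsilon> f 0 x"
      then show "1 \<le> \<zeta> x"
        using K(3)[of x] \<zeta>(3)[of x] layer_pos_iff[OF \<epsilon>, of f 0 x] by (cases "x \<in> K") auto
    qed
    moreover have "I (layer \<epsilon> f (Suc k)) \<le> J (layer \<epsilon> f k)" for k
    proof (rule dominate[OF layers layers(1,2)])
      fix x assume "0 < layer \<epsilon> f (Suc k) x"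
      then show "1 \<le> layer \<epsilon> f k x"
        using layer_pos_iff[OF \<epsilon>, of f "Suc k" x] layer_eq_1[OF \<epsilon>, of k f x] by simp
    qed
    ultimately have "(\<Sum>k<Suc N. I (layer \<epsilon> f k)) \<le> J \<zeta> + (\<Sum>k<N. J (layer \<epsilon> f k))"
      unfolding sum.lessThan_Suc_shift by (intro add_mono sum_mono)
    then have "\<epsilon> * (\<Sum>k<Suc N. I (layer \<epsilon> f k)) \<le> \<epsilon> * (J \<zeta> + (\<Sum>k<N. J (layer \<epsilon> f k)))"
      using \<epsilon> by (intro mult_left_mono) auto
    then show ?thesis
      using positive_functional_sum_layers[OF assms(1) f(1) \<epsilon> f(2) N(2)]
        positive_functional_sum_layers[OF assms(3) f(1) \<epsilon> f(2) N(1)]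
      by (simp only: distrib_left add.commute)
  qed
  then show ?thesis
    by (rule real_le_if_le_add_mult)
qed

lemma level_set_bounds_unique:
  assumes I: "positive_functional R I" "level_set_bounds R \<mu> I"
    and J: "positive_functional R J" "level_set_bounds R \<mu> J" and f: "f \<in> Cc R"
  shows "I f = J f"
proof -
  let ?p = "\<lambda>x. max (f x) 0" and ?n = "\<lambda>x. max (-1 * f x) 0"
  have parts: "?p \<in> Cc R" "?n \<in> Cc R"
    using Cc_max_zero[OF f] Cc_max_zero[OF Cc_cmult[OF f, of "-1"]] by auto
  have "I ?p = J ?p" "I ?n = J ?n"
    using parts by (auto intro!: antisym level_set_bounds_le[OF I J] level_set_bounds_le[OF J I])
  moreover have "(\<lambda>x. ?p x - ?n x) = f"
    by auto
  ultimately show ?thesis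
    using positive_functional.L_diff[OF I(1) parts] positive_functional.L_diff[OF J(1) parts] by simp
qed

lemma level_set_bounds_integral:
  assumes "radon_pos_on R \<mu>"
  shows "level_set_bounds R \<mu> (integral\<^sup>L \<mu>)"
  unfolding level_set_bounds_def
proof (intro ballI impI conjI allI)
  fix f assume f: "f \<in> Cc R" "\<forall>x. 0 \<le> f x"
  have sets: "sets \<mu> = sets borel"
    using assms by (simp add: radon_pos_on_def)
  have nn_integral: "ennreal (integral\<^sup>L \<mu> f) = (\<integral>\<^sup>+ x. ennreal (f x) \<partial>\<mu>)"
    using nn_integral_eq_integral[OF integrable_Cc[OF assms f(1)]] f(2) by simp
  have "open {x. 0 < f x}"
    by (intro open_Collect_less continuous_on_const Cc_continuous_on[OF f(1)])
  then have "{x. 0 < f x} \<in> sets \<mu>"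
    by (simp add: sets borel_open)
  show "ennreal (integral\<^sup>L \<mu> f) \<le> emeasure \<mu> {x. 0 < f x}" if "\<forall>x. f x \<le> 1"
  proof -
    have "(\<integral>\<^sup>+ x. ennreal (f x) \<partial>\<mu>) \<le> (\<integral>\<^sup>+ x. indicator {x. 0 < f x} x \<partial>\<mu>)"
      using f(2) that
      by (intro nn_integral_mono) (auto simp: indicator_def ennreal_le_1 not_less ennreal_neg)
    then show ?thesis
      using \<open>{x. 0 < f x} \<in> sets \<mu>\<close> by (simp add: nn_integral)
  qed
  show "emeasure \<mu> A \<le> ennreal (integral\<^sup>L \<mu> f)" if "open A \<and> (\<forall>x\<in>A. 1 \<le> f x)" for A
  proof -
    have "(\<integral>\<^sup>+ x. indicator A x \<partial>\<mu>) \<le> (\<integral>\<^sup>+ x. ennreal (f x) \<partial>\<mu>)"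
      using that by (intro nn_integral_mono) (auto simp: indicator_def ennreal_ge_1)
    then show ?thesis
      using that by (simp add: nn_integral sets borel_open)
  qed
qed

theorem riesz_representation:
  assumes "positive_functional R L"
  obtains \<mu> where "radon_pos_on R \<mu>" "\<And>f. f \<in> Cc R \<Longrightarrow> integral\<^sup>L \<mu> f = L f"
proof -
  interpret L: positive_functional R L
    by (rule assms)
  have "level_set_bounds R L.riesz_measure L"
    unfolding level_set_bounds_def by (auto intro!: L.L_le_riesz_measure L.riesz_measure_le_L borel_open)
  then have "integral\<^sup>L L.riesz_measure f = L f" if "f \<in> Cc R" for f
    using level_set_bounds_unique[OF positive_functional_integral[OF L.open_R L.radon_riesz_measure]
        level_set_bounds_integral[OF L.radon_riesz_measure] assms] that by blast
  with L.radon_riesz_measure show ?thesis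
    by (rule that)
qed

section \<open>Vague limits of positive functionals\<close>

lemma positive_functional_restrict:
  assumes "positive_functional A L" "open R" "R \<subseteq> A"
  shows "positive_functional R L"
proof -
  interpret positive_functional A L
    by (rule assms(1))
  show ?thesis
    using Cc_mono[OF assms(3)] assms(2)
    by unfold_locales (auto intro: L_add L_cmult L_nonneg)
qed

lemma positive_functional_limit:
  assumes "open R" "F \<noteq> bot" and functional: "\<forall>\<^sub>F t in F. positive_functional R (P t)"
    and limit: "\<And>f. f \<in> Cc R \<Longrightarrow> ((\<lambda>t. P t f) \<longlongrightarrow> L f) F"
  shows "positive_functional R L"
proof
  show "L (\<lambda>x. f x + h x) = L f + L h" if "f \<in> Cc R" "h \<in> Cc R" for f h
  proof (rule tendsto_unique[OF assms(2) limit[OF Cc_add[OF that]]])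
    have "\<forall>\<^sub>F t in F. P t f + P t h = P t (\<lambda>x. f x + h x)"
      using functional by eventually_elim (simp add: positive_functional.L_add that)
    then show "((\<lambda>t. P t (\<lambda>x. f x + h x)) \<longlongrightarrow> L f + L h) F"
      by (rule Lim_transform_eventually[OF tendsto_add[OF limit[OF that(1)] limit[OF that(2)]]])
  qed
  show "L (\<lambda>x. c * f x) = c * L f" if "f \<in> Cc R" for f c
  proof (rule tendsto_unique[OF assms(2) limit[OF Cc_cmult[OF that]]])
    have "\<forall>\<^sub>F t in F. c * P t f = P t (\<lambda>x. c * f x)"
      using functional by eventually_elim (simp add: positive_functional.L_cmult that)
    then show "((\<lambda>t. P t (\<lambda>x. c * f x)) \<longlongrightarrow> c * L f) F"
      by (rule Lim_transform_eventually[OF tendsto_mult_left[OF limit[OF that]]])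
  qed
  show "0 \<le> L f" if "f \<in> Cc R" "\<And>x. 0 \<le> f x" for f
  proof (rule tendsto_lowerbound[OF limit[OF that(1)] _ assms(2)])
    show "\<forall>\<^sub>F t in F. 0 \<le> P t f"
      using functional by eventually_elim (rule positive_functional.L_nonneg[OF _ that])
  qed
qed (rule assms(1))

lemma convergent_if_approximable:
  fixes f :: "'b \<Rightarrow> real"
  assumes "F \<noteq> bot" and approximable: "\<And>e. 0 < e \<Longrightarrow> \<exists>l. \<forall>\<^sub>F t in F. \<bar>f t - l\<bar> < e"
  shows "\<exists>l. (f \<longlongrightarrow> l) F"
proof -
  have "cauchy_filter (filtermap f F)"
    unfolding cauchy_filter_metric_filtermap
  proof (intro allI impI)
    fix e :: real assume "0 < e"
    then obtain l where "\<forall>\<^sub>F t in F. \<bar>f t - l\<bar> < e / 2"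
      using approximable[of "e / 2"] by auto
    then show "\<exists>P. eventually P F \<and> (\<forall>s t. P s \<and> P t \<longrightarrow> dist (f s) (f t) < e)"
      by (intro exI[of _ "\<lambda>t. \<bar>f t - l\<bar> < e / 2"]) (auto simp only: dist_real_def)
  qed
  then show ?thesis
    using assms(1) cauchy_filter_complete_converges[of "filtermap f F" UNIV]
    by (simp add: filterlim_def complete_UNIV filtermap_bot_iff)
qed

lemma convergent_on_Cc:
  fixes R :: "'a::euclidean_space set"
  assumes "open R" "F \<noteq> bot" and functional: "\<forall>\<^sub>F t in F. positive_functional R (P t)"
    and test_convergent: "\<And>\<xi>. test_fun R \<xi> \<Longrightarrow> \<exists>l. ((\<lambda>t. P t \<xi>) \<longlongrightarrow> l) F" and "\<psi> \<in> Cc R"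
  shows "\<exists>l. ((\<lambda>t. P t \<psi>) \<longlongrightarrow> l) F"
proof (rule convergent_if_approximable[OF assms(2)])
  fix e :: real assume "0 < e"
  obtain \<zeta> where \<zeta>: "test_fun R \<zeta>"
    and dense: "\<And>e. 0 < e \<Longrightarrow> \<exists>\<xi>. test_fun R \<xi> \<and> (\<forall>x. \<bar>\<psi> x - \<xi> x\<bar> \<le> e * \<zeta> x)"
    using test_fun_dense[OF assms(1) \<open>\<psi> \<in> Cc R\<close>] by blast
  obtain m where m: "((\<lambda>t. P t \<zeta>) \<longlongrightarrow> m) F"
    using test_convergent[OF \<zeta>] by blast
  obtain M where "0 < M" "m < M"
    by (rule that[of "\<bar>m\<bar> + 1"]) auto
  define d where "d = e / (2 * M)"
  have "0 < d"
    using \<open>0 < e\<close> \<open>0 < M\<close> by (simp add: d_def)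
  then obtain \<xi> where \<xi>: "test_fun R \<xi>" "\<And>x. \<bar>\<psi> x - \<xi> x\<bar> \<le> d * \<zeta> x"
    using dense by blast
  obtain l where l: "((\<lambda>t. P t \<xi>) \<longlongrightarrow> l) F"
    using test_convergent[OF \<xi>(1)] by blast
  have "\<forall>\<^sub>F t in F. \<bar>P t \<psi> - l\<bar> < e"
    using functional order_tendstoD(2)[OF m \<open>m < M\<close>] tendstoD[OF l half_gt_zero[OF \<open>0 < e\<close>]]
  proof eventually_elim
    case (elim t)
    have "\<bar>P t \<psi> - P t \<xi>\<bar> \<le> d * P t \<zeta>"
      by (rule positive_functional.abs_L_diff_le[OF elim(1) \<open>\<psi> \<in> Cc R\<close> test_fun_Cc[OF \<xi>(1)]
            test_fun_Cc[OF \<zeta>] \<xi>(2)])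
    also have "d * P t \<zeta> \<le> d * M"
      using elim(2) \<open>0 < d\<close> by (intro mult_left_mono) auto
    also have "\<dots> = e / 2"
      using \<open>0 < M\<close> by (simp add: d_def)
    finally have "\<bar>P t \<psi> - P t \<xi>\<bar> \<le> e / 2" .
    then show ?case
      using elim(3) unfolding dist_real_def by linarith
  qed
  then show "\<exists>l. \<forall>\<^sub>F t in F. \<bar>P t \<psi> - l\<bar> < e"
    by blast
qed

theorem vague_limit_exists:
  fixes R :: "'a::euclidean_space set"
  assumes "open R" "F \<noteq> bot" "\<forall>\<^sub>F t in F. positive_functional R (P t)"
    and "\<And>\<xi>. test_fun R \<xi> \<Longrightarrow> \<exists>l. ((\<lambda>t. P t \<xi>) \<longlongrightarrow> l) F"
  obtains \<mu> where "radon_pos_on R \<mu>" "\<And>\<psi>. \<psi> \<in> Cc R \<Longrightarrow> ((\<lambda>t. P t \<psi>) \<longlongrightarrow> integral\<^sup>L \<mu> \<psi>) F"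
proof -
  have limit: "((\<lambda>t. P t \<psi>) \<longlongrightarrow> Lim F (\<lambda>t. P t \<psi>)) F" if "\<psi> \<in> Cc R" for \<psi>
    using convergent_on_Cc[OF assms that] tendsto_Lim[OF assms(2)] by blast
  then have "positive_functional R (\<lambda>\<psi>. Lim F (\<lambda>t. P t \<psi>))"
    by (rule positive_functional_limit[OF assms(1-3)])
  then obtain \<mu> where \<mu>: "radon_pos_on R \<mu>"
      "\<And>\<psi>. \<psi> \<in> Cc R \<Longrightarrow> integral\<^sup>L \<mu> \<psi> = Lim F (\<lambda>t. P t \<psi>)"
    using riesz_representation by blast
  show ?thesis
    by (rule that[OF \<mu>(1)]) (simp add: \<mu>(2) limit)
qed

section \<open>Locally integrable functions\<close>

definition locally_integrable_on ::
    "'a::euclidean_space set \<Rightarrow> ('a \<Rightarrow> 'b::{banach, second_countable_topology}) \<Rightarrow> bool" where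
  "locally_integrable_on A f \<longleftrightarrow> (\<forall>K. compact K \<and> K \<subseteq> A \<longrightarrow> set_integrable lborel K f)"

lemma locally_integrable_onD: "locally_integrable_on A f \<Longrightarrow> compact K \<Longrightarrow> K \<subseteq> A \<Longrightarrow> set_integrable lborel K f"
  by (simp add: locally_integrable_on_def)

lemma locally_integrable_inner:
  "locally_integrable_on A f \<Longrightarrow> locally_integrable_on A (\<lambda>x. f x \<bullet> v)"
  using integrable_inner_left[of v lborel "\<lambda>x. indicator K x *\<^sub>R f x" for K]
  by (auto simp: locally_integrable_on_def set_integrable_def)

lemma continuous_imp_locally_integrable: "continuous_on A f \<Longrightarrow> locally_integrable_on A f"
  unfolding locally_integrable_on_def set_integrable_def
  by (auto intro: borel_integrable_compact continuous_on_subset)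

lemma set_integrable_mult_continuous:
  fixes f h :: "'a::euclidean_space \<Rightarrow> real"
  assumes f: "set_integrable lborel K f" and "compact K" "continuous_on UNIV h"
  shows "set_integrable lborel K (\<lambda>x. f x * h x)"
proof -
  have "bounded (h ` K)"
    using assms(2,3)
    by (intro compact_imp_bounded compact_continuous_image) (auto intro: continuous_on_subset)
  then obtain B where "B > 0" and B: "\<And>x. x \<in> K \<Longrightarrow> \<bar>h x\<bar> \<le> B"
    unfolding bounded_pos by auto
  have "set_integrable lborel K (\<lambda>x. B * f x)"
    using f by simp
  then show ?thesis
  proof (rule set_integrable_bound)
    have "(\<lambda>x. (indicator K x *\<^sub>R f x) * h x) \<in> borel_measurable lborel"
      using f borel_measurable_continuous_onI[OF assms(3)]
      by (intro borel_measurable_times) (auto simp: set_integrable_def)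
    then show "set_borel_measurable lborel K (\<lambda>x. f x * h x)"
      by (simp add: set_borel_measurable_def mult.assoc)
    show "AE x in lborel. x \<in> K \<longrightarrow> norm (f x * h x) \<le> norm (B * f x)"
      using B \<open>B > 0\<close> by (auto simp: abs_mult mult.commute[of B] intro!: mult_left_mono)
  qed
qed

lemma integrable_mult_Cc:
  fixes f :: "'a::euclidean_space \<Rightarrow> real"
  assumes "locally_integrable_on A f" "\<phi> \<in> Cc A"
  shows "integrable lborel (\<lambda>x. f x * \<phi> x)"
proof -
  obtain K where K: "compact K" "K \<subseteq> A" "\<And>x. x \<notin> K \<Longrightarrow> \<phi> x = 0"
    using CcE[OF assms(2)] by blast
  have "set_integrable lborel K (\<lambda>x. f x * \<phi> x)"
    by (rule set_integrable_mult_continuous[OF locally_integrable_onD[OF assms(1) K(1,2)] K(1)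
          Cc_continuous_on[OF assms(2)]])
  moreover have "(\<lambda>x. indicator K x *\<^sub>R (f x * \<phi> x)) = (\<lambda>x. f x * \<phi> x)"
    using K(3) by (auto simp: indicator_def fun_eq_iff)
  ultimately show ?thesis
    by (simp add: set_integrable_def)
qed

section \<open>Integrals over time slabs\<close>

lemma slab_measurable:
  "A \<in> sets borel \<Longrightarrow> A \<times> {s<..t} \<in> sets (lborel :: ('a::euclidean_space \<times> real) measure)"
  by (simp add: borel_Times)

lemma decreasing_null_sequence:
  obtains S :: "nat \<Rightarrow> real" where "\<And>n. 0 < S n" "decseq S" "S \<longlonglongrightarrow> 0"
proof
  show "decseq (\<lambda>n. inverse (real (Suc n)))"
    by (auto simp: decseq_def)
qed (simp, rule LIMSEQ_inverse_real_of_nat)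

lemma incseq_slab: "decseq S \<Longrightarrow> incseq (\<lambda>n. A \<times> {S n<..\<tau>})"
  by (fastforce simp: incseq_def decseq_def intro: le_less_trans)

lemma UN_slab:
  fixes S :: "nat \<Rightarrow> real"
  assumes "\<And>n. 0 < S n" "S \<longlonglongrightarrow> 0"
  shows "(\<Union>n. A \<times> {S n<..\<tau>}) = A \<times> {0<..\<tau>}"
proof -
  have "\<exists>n. S n < t" if "0 < t" for t
    using order_tendstoD(2)[OF assms(2) that] by (auto simp: eventually_sequentially)
  then show ?thesis
    using less_trans[OF assms(1)] by auto
qed

lemma tendsto_slab_integral:
  fixes F :: "'a::euclidean_space \<times> real \<Rightarrow> real"
  assumes "A \<in> sets borel" "set_integrable lborel (A \<times> {0<..\<tau>}) F"
  shows "((\<lambda>s. LINT z:A \<times> {s<..\<tau>}|lborel. F z) \<longlongrightarrow> (LINT z:A \<times> {0<..\<tau>}|lborel. F z)) (at_right 0)"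
proof (rule tendsto_at_right_sequentially[OF zero_less_one])
  fix S :: "nat \<Rightarrow> real"
  assume S: "\<And>n. 0 < S n" "decseq S" "S \<longlonglongrightarrow> 0"
  show "(\<lambda>n. LINT z:A \<times> {S n<..\<tau>}|lborel. F z) \<longlonglongrightarrow> (LINT z:A \<times> {0<..\<tau>}|lborel. F z)"
    using set_integral_cont_up[OF slab_measurable[OF assms(1)] incseq_slab[OF S(2)]] assms(2)
    unfolding UN_slab[OF S(1,3)] .
qed

lemma slab_integral_at_top:
  fixes F :: "'a::euclidean_space \<times> real \<Rightarrow> real"
  assumes "A \<in> sets borel" and F_nonneg: "\<And>z. 0 \<le> F z"
    and truncated: "\<And>s. 0 < s \<Longrightarrow> set_integrable lborel (A \<times> {s<..\<tau>}) F"
    and divergent: "\<not> set_integrable lborel (A \<times> {0<..\<tau>}) F"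
  shows "LIM s at_right 0. (LINT z:A \<times> {s<..\<tau>}|lborel. F z) :> at_top"
proof (rule ccontr)
  let ?I = "\<lambda>s. LINT z:A \<times> {s<..\<tau>}|lborel. F z"
  assume "\<not> (LIM s at_right 0. ?I s :> at_top)"
  then obtain C where C: "\<not> (\<forall>\<^sub>F s in at_right 0. C \<le> ?I s)"
    unfolding filterlim_at_top by blast
  have I_mono: "?I t \<le> ?I s" if "0 < s" "s \<le> t" for s t
    using truncated[of s] truncated[of t] that F_nonneg
    unfolding set_lebesgue_integral_def set_integrable_def
    by (intro integral_mono) (auto split: split_indicator)
  have bounded: "?I s \<le> C" if "0 < s" for s
  proof (rule ccontr)
    assume "\<not> ?I s \<le> C"
    then have "\<forall>\<^sub>F t in at_right 0. C \<le> ?I t"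
      unfolding eventually_at_right_field using I_mono \<open>0 < s\<close>
      by (intro exI[of _ s]) (auto intro: order_trans[of C "?I s"])
    with C show False ..
  qed
  obtain S :: "nat \<Rightarrow> real" where S: "\<And>n. 0 < S n" "decseq S" "S \<longlonglongrightarrow> 0"
    using decreasing_null_sequence by blast
  have "incseq (\<lambda>n. ?I (S n))"
    using S(2) by (auto simp: decseq_def intro!: monoI I_mono S(1))
  then obtain l where "(\<lambda>n. ?I (S n)) \<longlonglongrightarrow> l"
    using incseq_convergent[of "\<lambda>n. ?I (S n)" C] bounded[OF S(1)] by blast
  then have "set_integrable lborel (\<Union>n. A \<times> {S n<..\<tau>}) F"
    by (rule pos_integrable_to_top[OF slab_measurable[OF assms(1)] incseq_slab[OF S(2)] F_nonneg
          truncated[OF S(1)]])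
  with divergent show False
    by (simp add: UN_slab[OF S(1,3)])
qed

lemma set_borel_measurable_slab:
  fixes F :: "'a::euclidean_space \<times> real \<Rightarrow> real"
  assumes "\<And>s. 0 < s \<Longrightarrow> set_borel_measurable lborel (A \<times> {s<..\<tau>}) F"
  shows "set_borel_measurable lborel (A \<times> {0<..\<tau>}) F"
proof -
  obtain S :: "nat \<Rightarrow> real" where S: "\<And>n. 0 < S n" "S \<longlonglongrightarrow> 0"
    using decreasing_null_sequence by metis
  have "(\<lambda>z. indicator (A \<times> {S n<..\<tau>}) z *\<^sub>R F z) \<in> borel_measurable lborel" for n
    using assms[OF S(1)] by (simp add: set_borel_measurable_def)
  moreover have "(\<lambda>n. indicator (A \<times> {S n<..\<tau>}) z *\<^sub>R F z) \<longlonglongrightarrow> indicator (A \<times> {0<..\<tau>}) z *\<^sub>R F z" for z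
  proof (rule tendsto_eventually, cases "0 < snd z")
    case True
    from order_tendstoD(2)[OF S(2) True]
    show "\<forall>\<^sub>F n in sequentially.
        indicator (A \<times> {S n<..\<tau>}) z *\<^sub>R F z = indicator (A \<times> {0<..\<tau>}) z *\<^sub>R F z"
      by eventually_elim (use True in \<open>auto simp: indicator_def mem_Times_iff\<close>)
  next
    case False
    then have "z \<notin> A \<times> {S n<..\<tau>}" "z \<notin> A \<times> {0<..\<tau>}" for n
      using less_trans[of 0 "S n" "snd z"] S(1) by (auto simp: mem_Times_iff)
    then show "\<forall>\<^sub>F n in sequentially.
        indicator (A \<times> {S n<..\<tau>}) z *\<^sub>R F z = indicator (A \<times> {0<..\<tau>}) z *\<^sub>R F z"
      by simp
  qed
  ultimately show ?thesis
    unfolding set_borel_measurable_def by (rule borel_measurable_LIMSEQ_metric)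
qed

lemma set_integrable_const_slab:
  fixes K :: "'a::euclidean_space set" and s t c :: real
  assumes "compact K"
  shows "set_integrable lborel (K \<times> {s<..t}) (\<lambda>_. c)"
proof -
  have "bounded {s<..t}"
    by (rule bounded_subset[OF compact_imp_bounded[OF compact_Icc[of s t]]]) auto
  then have "bounded (K \<times> {s<..t})"
    by (rule bounded_Times[OF compact_imp_bounded[OF assms]])
  then have "emeasure lborel (K \<times> {s<..t}) < \<infinity>"
    by (rule emeasure_bounded_finite)
  then show ?thesis
    unfolding set_integrable_def using slab_measurable[OF borel_compact[OF assms]]
    by (intro integrable_scaleR_left integrable_real_indicator) auto
qed

section \<open>Weak derivatives in time\<close>

definition ramp :: "real \<Rightarrow> real \<Rightarrow> real \<Rightarrow> real" where
  "ramp s w \<sigma> = smooth_step ((\<sigma> - s) / w)"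

lemma smooth_ramp: "smooth (ramp s w)"
proof -
  have "smooth (\<lambda>\<sigma>. (\<sigma> - s) * inverse w)"
    by (intro smooth_mult smooth_diff smooth_const smooth_bounded_linear bounded_linear_ident)
  then show ?thesis
    unfolding ramp_def[abs_def] divide_inverse
    by (intro smooth_compose[OF smooth_smooth_step]) simp
qed

lemma ramp_left: "0 < w \<Longrightarrow> \<sigma> \<le> s \<Longrightarrow> ramp s w \<sigma> = 0"
  by (simp add: ramp_def smooth_step_eq_0 divide_nonpos_pos)

lemma ramp_right: "0 < w \<Longrightarrow> s + w \<le> \<sigma> \<Longrightarrow> ramp s w \<sigma> = 1"
  by (simp add: ramp_def smooth_step_eq_1)

lemma dderiv_ramp: "dderiv [1] (ramp s w) \<sigma> = dderiv [1] smooth_step ((\<sigma> - s) / w) / w"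
proof (rule dderiv_real_eqI)
  have "((\<lambda>\<sigma>. (\<sigma> - s) / w) has_real_derivative 1 / w) (at \<sigma>)"
    by (intro DERIV_cdivide) (auto intro!: derivative_eq_intros)
  from DERIV_chain2[OF smooth_has_real_derivative[OF smooth_smooth_step] this]
  show "(ramp s w has_real_derivative dderiv [1] smooth_step ((\<sigma> - s) / w) / w) (at \<sigma>)"
    by (simp add: ramp_def[abs_def])
qed

lemma dderiv_ramp_Cc:
  assumes "0 < w" "{s..s + w} \<subseteq> J"
  shows "dderiv [1] (ramp s w) \<in> Cc J"
proof (rule CcI[OF _ compact_Icc assms(2)])
  show "continuous_on UNIV (dderiv [1] (ramp s w))"
    by (intro smooth_continuous_on smooth_dderiv smooth_ramp) simp
  fix \<sigma> assume "\<sigma> \<notin> {s..s + w}"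
  then consider "\<sigma> < s" | "s + w < \<sigma>"
    by fastforce
  then show "dderiv [1] (ramp s w) \<sigma> = 0"
  proof cases
    assume "\<sigma> < s"
    then show ?thesis
      by (intro dderiv_locally_const[of "{..<s}" _ _ 0]) (auto simp: ramp_left assms(1))
  next
    assume "s + w < \<sigma>"
    then show ?thesis
      by (intro dderiv_locally_const[of "{s + w<..}" _ _ 1]) (auto simp: ramp_right assms(1))
  qed
qed

lemma smooth_step_kernel:
  shows "dderiv [1] smooth_step \<in> Cc {0..1}"
    and "has_bochner_integral lborel (dderiv [1] smooth_step) 1"
proof -
  have "ramp 0 1 = smooth_step"
    by (simp add: ramp_def fun_eq_iff)
  then show kernel: "dderiv [1] smooth_step \<in> Cc {0..1}"
    using dderiv_ramp_Cc[of 1 0 "{0..1}"] by simp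
  have restrict: "(\<lambda>\<sigma>. dderiv [1] smooth_step \<sigma> * indicator {0..1} \<sigma>) = dderiv [1] smooth_step"
    using Cc_zero_outside[OF kernel] by (auto simp: indicator_def fun_eq_iff)
  have "has_bochner_integral lborel (\<lambda>\<sigma>. dderiv [1] smooth_step \<sigma> * indicator {0..1} \<sigma>)
      (smooth_step 1 - smooth_step 0)"
    using Cc_continuous_on[OF kernel, of UNIV]
    by (intro has_bochner_integral_FTC_Icc_real smooth_has_real_derivative smooth_smooth_step)
      (auto simp: continuous_on_eq_continuous_at)
  then show "has_bochner_integral lborel (dderiv [1] smooth_step) 1"
    by (simp only: restrict smooth_step_eq_0 smooth_step_eq_1 order_refl diff_zero)
qed

lemma rescaled_mem_Icc:
  fixes w :: real
  assumes "y \<in> {0..1}" "0 < w" "w \<le> \<delta>"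
  shows "s + w * y \<in> {s..s + \<delta>}"
proof -
  have "w * y \<le> w" "0 \<le> w * y"
    using assms by (auto intro: mult_left_le)
  with assms(3) show ?thesis
    unfolding atLeastAtMost_iff by linarith
qed

lemma integral_rescale:
  fixes U k :: "real \<Rightarrow> real"
  assumes "0 < w"
  shows "(LINT \<sigma>|lborel. U \<sigma> * (k ((\<sigma> - s) / w) / w)) = (LINT y|lborel. U (s + w * y) * k y)"
proof -
  have "(LINT \<sigma>|lborel. U \<sigma> * (k ((\<sigma> - s) / w) / w)) = \<bar>w\<bar> *\<^sub>R (LINT y|lborel. U (s + w * y) * (k y / w))"
    using assms by (subst lborel_integral_real_affine[of w _ s]) auto
  also have "\<dots> = (LINT y|lborel. U (s + w * y) * k y)"
    using assms by simp
  finally show ?thesis .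
qed

lemma approximate_identity:
  fixes U k :: "real \<Rightarrow> real"
  assumes k: "k \<in> Cc {0..1}" "has_bochner_integral lborel k 1"
    and U: "continuous_on {s..s + \<delta>} U"
    and w: "\<And>n. 0 < w n" "\<And>n. w n \<le> \<delta>" "w \<longlonglongrightarrow> 0"
  shows "(\<lambda>n. LINT \<sigma>|lborel. U \<sigma> * (k ((\<sigma> - s) / w n) / w n)) \<longlonglongrightarrow> U s"
proof -
  note inside = rescaled_mem_Icc[OF _ w(1,2)]
  obtain B where B: "\<forall>\<sigma>\<in>{s..s + \<delta>}. \<bar>U \<sigma>\<bar> \<le> B"
    using compact_imp_bounded[OF compact_continuous_image[OF U compact_Icc]] by (auto simp: bounded_iff)
  have "(\<lambda>n. LINT y|lborel. U (s + w n * y) * k y) \<longlonglongrightarrow> (LINT y|lborel. U s * k y)"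
  proof (rule integral_dominated_convergence)
    show "integrable lborel (\<lambda>y. B * \<bar>k y\<bar>)" "(\<lambda>y. U s * k y) \<in> borel_measurable lborel"
      using integrable.intros[OF k(2)] by auto
    show "(\<lambda>y. U (s + w n * y) * k y) \<in> borel_measurable lborel" for n
    proof -
      have "continuous_on {0..1} (\<lambda>y. U (s + w n * y))"
        by (rule continuous_on_compose2[OF U]) (use inside in \<open>auto intro!: continuous_intros\<close>)
      then show ?thesis
        by (intro borel_measurable_integrable integrable_mult_Cc[OF continuous_imp_locally_integrable k(1)])
    qed
    show "AE y in lborel. norm (U (s + w n * y) * k y) \<le> B * \<bar>k y\<bar>" for n
    proof (rule AE_I2)
      fix y show "norm (U (s + w n * y) * k y) \<le> B * \<bar>k y\<bar>"
        using bspec[OF B inside] Cc_zero_outside[OF k(1), of y]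
        by (cases "y \<in> {0..1}") (auto simp: abs_mult intro!: mult_right_mono)
    qed
    show "AE y in lborel. (\<lambda>n. U (s + w n * y) * k y) \<longlonglongrightarrow> U s * k y"
    proof (rule AE_I2)
      fix y show "(\<lambda>n. U (s + w n * y) * k y) \<longlonglongrightarrow> U s * k y"
      proof (cases "y \<in> {0..1}")
        case True
        have "(\<lambda>n. s + w n * y) \<longlonglongrightarrow> s"
          using w(3) by (auto intro!: tendsto_eq_intros)
        then have "(\<lambda>n. U (s + w n * y)) \<longlonglongrightarrow> U s"
          using inside[OF True] inside[of 0] by (intro continuous_on_tendsto_compose[OF U]) auto
        then show ?thesis
          by (intro tendsto_mult tendsto_const)
      qed (simp add: Cc_zero_outside[OF k(1)])
    qed
  qed
  then show ?thesis
    unfolding integral_rescale[OF w(1)] using has_bochner_integral_integral_eq[OF k(2)] by simp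
qed

lemma tendsto_integral_dderiv_ramp:
  assumes "continuous_on {s..s + \<delta>} U" "\<And>n. 0 < w n" "\<And>n. w n \<le> \<delta>" "w \<longlonglongrightarrow> 0"
  shows "(\<lambda>n. LINT \<sigma>|lborel. U \<sigma> * dderiv [1] (ramp s (w n)) \<sigma>) \<longlonglongrightarrow> U s"
  unfolding dderiv_ramp by (rule approximate_identity[OF smooth_step_kernel assms])

definition window :: "real \<Rightarrow> real \<Rightarrow> real \<Rightarrow> real \<Rightarrow> real" where
  "window s t w \<sigma> = ramp s w \<sigma> - ramp t w \<sigma>"

lemma smooth_window: "smooth (window s t w)"
  unfolding window_def[abs_def] by (intro smooth_diff smooth_ramp)

lemma window_eq_0:
  assumes "s \<le> t" "0 < w" "\<sigma> \<notin> {s..t + w}"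
  shows "window s t w \<sigma> = 0"
proof (cases "\<sigma> < s")
  case False
  then have "t + w \<le> \<sigma>" "s + w \<le> \<sigma>"
    using assms by auto
  then show ?thesis
    using assms(2) by (simp add: window_def ramp_right)
qed (use assms in \<open>simp add: window_def ramp_left\<close>)

lemma test_fun_window: "s \<le> t \<Longrightarrow> 0 < w \<Longrightarrow> {s..t + w} \<subseteq> J \<Longrightarrow> test_fun J (window s t w)"
  unfolding test_fun_iff
  by (intro conjI smooth_window CcI[OF smooth_continuous_on[OF smooth_window] compact_Icc] window_eq_0)

lemma abs_window_le_1: "\<bar>window s t w \<sigma>\<bar> \<le> 1"
  using smooth_step_nonneg[of "(\<sigma> - s) / w"] smooth_step_le_1[of "(\<sigma> - s) / w"]
    smooth_step_nonneg[of "(\<sigma> - t) / w"] smooth_step_le_1[of "(\<sigma> - t) / w"]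
  unfolding window_def ramp_def by linarith

lemma dderiv_window: "dderiv [1] (window s t w) \<sigma> = dderiv [1] (ramp s w) \<sigma> - dderiv [1] (ramp t w) \<sigma>"
  unfolding window_def[abs_def]
  by (rule dderiv_real_eqI) (intro DERIV_diff smooth_has_real_derivative smooth_ramp)

lemma tendsto_window:
  assumes "s \<le> t" "\<And>n. 0 < w n" "w \<longlonglongrightarrow> 0"
  shows "(\<lambda>n. window s t (w n) \<sigma>) \<longlonglongrightarrow> indicator {s<..t} \<sigma>"
proof -
  have ramp_limit: "\<forall>\<^sub>F n in sequentially. ramp r (w n) \<sigma> = (if r < \<sigma> then 1 else 0)" for r
  proof (cases "r < \<sigma>")
    case True
    then have "\<forall>\<^sub>F n in sequentially. w n < \<sigma> - r"
      using order_tendstoD(2)[OF assms(3)] by simp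
    then show ?thesis
      by eventually_elim (use True in \<open>simp add: ramp_right assms(2)\<close>)
  qed (simp add: ramp_left assms(2))
  have "\<forall>\<^sub>F n in sequentially. window s t (w n) \<sigma> = indicator {s<..t} \<sigma>"
    using ramp_limit[of s] ramp_limit[of t]
    by eventually_elim (use assms(1) in \<open>auto simp: window_def indicator_def\<close>)
  then show ?thesis
    by (rule tendsto_eventually)
qed

lemma tendsto_integral_window:
  fixes F :: "'a::euclidean_space \<times> real \<Rightarrow> real"
  assumes F: "set_integrable lborel (UNIV \<times> {s..t + \<delta>}) F" and "s \<le> t"
    and w: "\<And>n. 0 < w n" "\<And>n. w n \<le> \<delta>" "w \<longlonglongrightarrow> 0"
  shows "(\<lambda>n. LINT z|lborel. F z * window s t (w n) (snd z)) \<longlonglongrightarrow> (LINT z:UNIV \<times> {s<..t}|lborel. F z)"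
  unfolding set_lebesgue_integral_def
proof (rule integral_dominated_convergence)
  let ?F = "\<lambda>z. indicator (UNIV \<times> {s..t + \<delta>}) z *\<^sub>R F z"
  have restrict: "F z * window s t (w n) (snd z) = ?F z * window s t (w n) (snd z)" for z n
    using window_eq_0[OF \<open>s \<le> t\<close> w(1), of "snd z" n] w(2)[of n]
    by (cases "snd z \<in> {s..t + w n}") (auto simp: indicator_def mem_Times_iff)
  show integrable: "integrable lborel (\<lambda>z. \<bar>?F z\<bar>)"
    using F by (auto simp: set_integrable_def)
  have "set_integrable lborel (UNIV \<times> {s<..t}) F"
    using w(1,2)[of 0] by (intro set_integrable_subset[OF F] slab_measurable) auto
  then show "(\<lambda>z. indicator (UNIV \<times> {s<..t}) z *\<^sub>R F z) \<in> borel_measurable lborel"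
    by (auto simp: set_integrable_def)
  have "continuous_on UNIV (\<lambda>z::'a \<times> real. window s t (w n) (snd z))" for n
    by (rule continuous_on_compose2[OF smooth_continuous_on[OF smooth_window] _ subset_UNIV])
      (rule continuous_on_snd[OF continuous_on_id])
  then show "(\<lambda>z. F z * window s t (w n) (snd z)) \<in> borel_measurable lborel" for n
    unfolding restrict using F
    by (intro borel_measurable_times)
      (auto simp: set_integrable_def intro: borel_measurable_continuous_onI)
  show "AE z in lborel. (\<lambda>n. F z * window s t (w n) (snd z)) \<longlonglongrightarrow> indicator (UNIV \<times> {s<..t}) z *\<^sub>R F z"
  proof (rule AE_I2)
    fix z :: "'a \<times> real"
    have "(\<lambda>n. F z * window s t (w n) (snd z)) \<longlonglongrightarrow> F z * indicator {s<..t} (snd z)"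
      by (intro tendsto_mult_left tendsto_window \<open>s \<le> t\<close> w(1,3))
    also have "F z * indicator {s<..t} (snd z) = indicator (UNIV \<times> {s<..t}) z *\<^sub>R F z"
      by (simp add: indicator_def mem_Times_iff)
    finally show "(\<lambda>n. F z * window s t (w n) (snd z)) \<longlonglongrightarrow> indicator (UNIV \<times> {s<..t}) z *\<^sub>R F z" .
  qed
  show "AE z in lborel. norm (F z * window s t (w n) (snd z)) \<le> \<bar>?F z\<bar>" for n
    unfolding restrict using abs_window_le_1 by (intro AE_I2) (simp add: abs_mult mult_left_le)
qed

lemma weak_derivative_increment:
  fixes U :: "real \<Rightarrow> real" and F :: "'a::euclidean_space \<times> real \<Rightarrow> real"
  assumes U: "continuous_on J U" and F: "\<And>a b. {a..b} \<subseteq> J \<Longrightarrow> set_integrable lborel (UNIV \<times> {a..b}) F"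
    and weak: "\<And>\<theta>. test_fun J \<theta> \<Longrightarrow>
      (LINT t|lborel. U t * dderiv [1] \<theta> t) = (LINT z|lborel. F z * \<theta> (snd z))"
    and "open J" "s \<le> t" "{s..t} \<subseteq> J"
  shows "U s - U t = (LINT z:UNIV \<times> {s<..t}|lborel. F z)"
proof -
  have "t \<in> J"
    using assms(5,6) by auto
  then obtain \<delta> where "0 < \<delta>" "cball t \<delta> \<subseteq> J"
    using \<open>open J\<close> open_contains_cball by blast
  moreover have "{s..t + \<delta>} \<subseteq> {s..t} \<union> cball t \<delta>"
    by (auto simp: dist_real_def)
  ultimately have subset_J: "{s..t + \<delta>} \<subseteq> J"
    using \<open>{s..t} \<subseteq> J\<close> by blast
  obtain S :: "nat \<Rightarrow> real" where S: "\<And>n. 0 < S n" "S \<longlonglongrightarrow> 0"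
    using decreasing_null_sequence by metis
  define w where "w n = min (S n) \<delta>" for n
  have w: "\<And>n. 0 < w n" "\<And>n. w n \<le> \<delta>" "w \<longlonglongrightarrow> 0"
    unfolding w_def using S(1) \<open>0 < \<delta>\<close> tendsto_min[OF S(2) tendsto_const, of \<delta>] by auto
  have window_in_J: "{r..r + w n} \<subseteq> J" "{s..t + w n} \<subseteq> J" if "r \<in> {s, t}" for r n
    using subset_J w(2)[of n] \<open>s \<le> t\<close> that by (auto simp: subset_iff)
  have ramp_limit: "(\<lambda>n. LINT \<sigma>|lborel. U \<sigma> * dderiv [1] (ramp r (w n)) \<sigma>) \<longlonglongrightarrow> U r" if "r \<in> {s, t}" for r
    using subset_J \<open>s \<le> t\<close> that
    by (intro tendsto_integral_dderiv_ramp[OF continuous_on_subset[OF U] w]) auto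
  have "integrable lborel (\<lambda>\<sigma>. U \<sigma> * dderiv [1] (ramp r (w n)) \<sigma>)" if "r \<in> {s, t}" for r n
    by (intro integrable_mult_Cc[OF continuous_imp_locally_integrable[OF U]] dderiv_ramp_Cc w(1)
        window_in_J that)
  then have "(LINT z|lborel. F z * window s t (w n) (snd z))
      = (LINT \<sigma>|lborel. U \<sigma> * dderiv [1] (ramp s (w n)) \<sigma>)
        - (LINT \<sigma>|lborel. U \<sigma> * dderiv [1] (ramp t (w n)) \<sigma>)" for n
    using weak[OF test_fun_window[OF \<open>s \<le> t\<close> w(1) window_in_J(2)], of s n]
    by (simp add: dderiv_window right_diff_distrib)
  then have "(\<lambda>n. LINT z|lborel. F z * window s t (w n) (snd z)) \<longlonglongrightarrow> U s - U t"
    using tendsto_diff[OF ramp_limit[of s] ramp_limit[of t]] by simp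
  then show ?thesis
    using tendsto_integral_window[OF F[OF subset_J] \<open>s \<le> t\<close> w] by (rule LIMSEQ_unique)
qed

section \<open>Weak solutions\<close>

lemma open_tint: "open (tint T)"
  unfolding tint_def by (intro open_Collect_conj open_Collect_less continuous_intros)

lemma Icc_subset_tint: "0 < s \<Longrightarrow> t \<in> tint T \<Longrightarrow> {s..t} \<subseteq> tint T"
  unfolding tint_def by (auto intro: le_less_trans[of "ereal _" "ereal t"])

lemma tint_nonempty:
  assumes "0 < T"
  obtains t where "t \<in> tint T"
proof -
  obtain z where "0 < z" "z < T"
    using dense[OF assms] by blast
  then show ?thesis
    by (cases z) (auto intro: that simp: tint_def)
qed

lemma eventually_tint:
  assumes "0 < T"
  shows "\<forall>\<^sub>F t in at_right 0. t \<in> tint T"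
proof -
  obtain \<tau> where \<tau>: "\<tau> \<in> tint T"
    using tint_nonempty[OF assms] .
  then have "0 < \<tau>"
    by (simp add: tint_def)
  moreover have "s \<in> tint T" if "0 < s" "s < \<tau>" for s
    using Icc_subset_tint[OF that(1) \<tau>] that(2) by auto
  ultimately show ?thesis
    unfolding eventually_at_right_field by blast
qed

locale nonneg_weak_solution =
  fixes q :: real and \<Omega> :: "'a::euclidean_space set" and T :: ereal
    and u :: "'a \<Rightarrow> real \<Rightarrow> real" and g :: "'a \<Rightarrow> real \<Rightarrow> 'a"
  assumes q_gt_1: "1 < q" and open_\<Omega>: "open \<Omega>" and T_pos: "0 < T"
    and u_slice: "t \<in> tint T \<Longrightarrow> locally_integrable_on \<Omega> (\<lambda>x. u x t)"
    and u_continuous: "compact K \<Longrightarrow> K \<subseteq> \<Omega> \<Longrightarrow> t \<in> tint T \<Longrightarrow>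
      ((\<lambda>s. LINT x:K|lborel. \<bar>u x s - u x t\<bar>) \<longlongrightarrow> 0) (at t within tint T)"
    and u_locally_integrable: "locally_integrable_on (cyl \<Omega> T) (\<lambda>z. u (fst z) (snd z))"
    and g_locally_integrable: "locally_integrable_on (cyl \<Omega> T) (\<lambda>z. g (fst z) (snd z))"
    and g_powr_locally_integrable: "locally_integrable_on (cyl \<Omega> T) (\<lambda>z. norm (g (fst z) (snd z)) powr q)"
    and weak_gradient: "test_fun (cyl \<Omega> T) \<phi> \<Longrightarrow> b \<in> Basis \<Longrightarrow>
      (LINT z|lborel. u (fst z) (snd z) * dderiv [(b, 0)] \<phi> z)
        = - (LINT z|lborel. (g (fst z) (snd z) \<bullet> b) * \<phi> z)"
    and weak_equation: "test_fun (cyl \<Omega> T) \<phi> \<Longrightarrow>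
      (LINT z|lborel. - u (fst z) (snd z) * dderiv [(0, 1)] \<phi> z
        - u (fst z) (snd z) * (\<Sum>b\<in>Basis. dderiv [(b, 0), (b, 0)] \<phi> z)
        + norm (g (fst z) (snd z)) powr q * \<phi> z) = 0"
    and u_nonneg: "x \<in> \<Omega> \<Longrightarrow> t \<in> tint T \<Longrightarrow> 0 \<le> u x t"
begin

definition absorption :: "'a \<times> real \<Rightarrow> real" where
  "absorption z = norm (g (fst z) (snd z)) powr q"

definition pairing :: "real \<Rightarrow> ('a \<Rightarrow> real) \<Rightarrow> real" where
  "pairing t \<xi> = (LINT x|lborel. u x t * \<xi> x)"

text \<open>Formally, \<open>- d/dt \<integral> u \<xi> = \<integral> dissipation \<xi>\<close>.\<close>
definition dissipation :: "('a \<Rightarrow> real) \<Rightarrow> 'a \<times> real \<Rightarrow> real" where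
  "dissipation \<xi> z =
    (\<Sum>b\<in>Basis. (g (fst z) (snd z) \<bullet> b) * dderiv [b] \<xi> (fst z)) + absorption z * \<xi> (fst z)"

lemma absorption_nonneg: "0 \<le> absorption z"
  by (simp add: absorption_def)

lemma absorption_locally_integrable: "locally_integrable_on (cyl \<Omega> T) absorption"
  using g_powr_locally_integrable by (simp add: absorption_def[abs_def])

lemma integrable_pairing: "\<xi> \<in> Cc \<Omega> \<Longrightarrow> t \<in> tint T \<Longrightarrow> integrable lborel (\<lambda>x. u x t * \<xi> x)"
  by (rule integrable_mult_Cc[OF u_slice])

lemma u_mult_nonneg:
  assumes "\<xi> \<in> Cc \<Omega>" "\<And>x. 0 \<le> \<xi> x" "t \<in> tint T"
  shows "0 \<le> u x t * \<xi> x"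
  using assms u_nonneg[of x t] Cc_zero_outside[OF assms(1), of x] by (cases "x \<in> \<Omega>") auto

lemma positive_functional_pairing:
  assumes "t \<in> tint T"
  shows "positive_functional \<Omega> (pairing t)"
proof
  show "pairing t (\<lambda>x. f x + h x) = pairing t f + pairing t h" if "f \<in> Cc \<Omega>" "h \<in> Cc \<Omega>" for f h
    using integrable_pairing[OF that(1) assms] integrable_pairing[OF that(2) assms]
    by (simp add: pairing_def distrib_left)
  show "pairing t (\<lambda>x. c * f x) = c * pairing t f" for f c
    unfolding pairing_def mult.left_commute[of _ c] by simp
  show "0 \<le> pairing t f" if "f \<in> Cc \<Omega>" "\<And>x. 0 \<le> f x" for f
    unfolding pairing_def by (intro Bochner_Integration.integral_nonneg u_mult_nonneg that assms)
qed (rule open_\<Omega>)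

lemma pairing_diff_le:
  assumes "compact K" "K \<subseteq> \<Omega>" "s \<in> tint T" "t \<in> tint T" "\<xi> \<in> Cc \<Omega>"
    and zero_off: "\<And>x. x \<notin> K \<Longrightarrow> \<xi> x = 0" and B: "\<And>x. \<bar>\<xi> x\<bar> \<le> B"
  shows "\<bar>pairing s \<xi> - pairing t \<xi>\<bar> \<le> B * (LINT x:K|lborel. \<bar>u x s - u x t\<bar>)"
proof -
  have "pairing s \<xi> - pairing t \<xi> = (LINT x|lborel. u x s * \<xi> x - u x t * \<xi> x)"
    unfolding pairing_def using integrable_pairing assms(3-5) by simp
  also have "norm \<dots> \<le> (LINT x|lborel. B * (indicator K x *\<^sub>R \<bar>u x s - u x t\<bar>))"
  proof (rule Bochner_Integration.integral_norm_bound_integral)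
    show "integrable lborel (\<lambda>x. u x s * \<xi> x - u x t * \<xi> x)"
      using integrable_pairing assms(3-5) by simp
    have "set_integrable lborel K (\<lambda>x. \<bar>u x s - u x t\<bar>)"
      by (intro set_integrable_abs set_integral_diff(1) locally_integrable_onD[OF u_slice] assms(1-4))
    then show "integrable lborel (\<lambda>x. B * (indicator K x *\<^sub>R \<bar>u x s - u x t\<bar>))"
      unfolding set_integrable_def by (rule integrable_mult_right)
    fix x
    have "norm (u x s * \<xi> x - u x t * \<xi> x) = \<bar>\<xi> x\<bar> * \<bar>u x s - u x t\<bar>"
      by (simp only: left_diff_distrib[symmetric] abs_mult real_norm_def) (rule mult.commute)
    also have "\<dots> \<le> B * (indicator K x *\<^sub>R \<bar>u x s - u x t\<bar>)"
      using zero_off[of x] B[of x] by (cases "x \<in> K") (auto intro!: mult_right_mono)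
    finally show "norm (u x s * \<xi> x - u x t * \<xi> x) \<le> B * (indicator K x *\<^sub>R \<bar>u x s - u x t\<bar>)" .
  qed
  finally show ?thesis
    by (simp add: set_lebesgue_integral_def)
qed

lemma continuous_on_pairing:
  assumes "\<xi> \<in> Cc \<Omega>"
  shows "continuous_on (tint T) (\<lambda>t. pairing t \<xi>)"
  unfolding continuous_on_def
proof
  fix t assume t: "t \<in> tint T"
  obtain K where K: "compact K" "K \<subseteq> \<Omega>" "\<And>x. x \<notin> K \<Longrightarrow> \<xi> x = 0"
    using CcE[OF assms] by blast
  obtain B where B: "0 < B" "\<And>x. \<bar>\<xi> x\<bar> \<le> B"
    using Cc_bounded[OF assms] by blast
  have "((\<lambda>s. pairing s \<xi> - pairing t \<xi>) \<longlongrightarrow> 0) (at t within tint T)"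
  proof (rule Lim_null_comparison)
    show "\<forall>\<^sub>F s in at t within tint T.
        norm (pairing s \<xi> - pairing t \<xi>) \<le> B * (LINT x:K|lborel. \<bar>u x s - u x t\<bar>)"
      using pairing_diff_le[OF K(1,2) _ t assms K(3) B(2)] by (simp add: eventually_at_filter)
    show "((\<lambda>s. B * (LINT x:K|lborel. \<bar>u x s - u x t\<bar>)) \<longlongrightarrow> 0) (at t within tint T)"
      using tendsto_mult_right_zero[OF u_continuous[OF K(1,2) t]] .
  qed
  then show "((\<lambda>t. pairing t \<xi>) \<longlongrightarrow> pairing t \<xi>) (at t within tint T)"
    by (rule LIM_zero_cancel)
qed

lemma weak_form_gradient:
  assumes \<phi>: "test_fun (cyl \<Omega> T) \<phi>"
  shows "(LINT z|lborel. u (fst z) (snd z) * dderiv [(0, 1)] \<phi> z)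
    = (LINT z|lborel. (\<Sum>b\<in>Basis. (g (fst z) (snd z) \<bullet> b) * dderiv [(b, 0)] \<phi> z) + absorption z * \<phi> z)"
proof -
  let ?u = "\<lambda>z. u (fst z) (snd z)" and ?g = "\<lambda>b z. g (fst z) (snd z) \<bullet> b"
  have Basis: "(0, 1) \<in> (Basis :: ('a \<times> real) set)" "b \<in> Basis \<Longrightarrow> (b, 0) \<in> (Basis :: ('a \<times> real) set)" for b
    by (auto simp: Basis_prod_def)
  have second_derivative: "dderiv [(b, 0), (b, 0)] \<phi> = dderiv [(b, 0)] (dderiv [(b, 0)] \<phi>)" for b
    using dderiv_append[of "[(b, 0)]" "[(b, 0)]" \<phi>] by simp
  note dx_test = test_fun_dderiv[OF \<phi> Basis(2)]
  have integrable: "integrable lborel (\<lambda>z. ?u z * dderiv [(0, 1)] \<phi> z)"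
      "integrable lborel (\<lambda>z. absorption z * \<phi> z)"
    by (rule integrable_mult_Cc[OF u_locally_integrable test_fun_Cc[OF test_fun_dderiv[OF \<phi> Basis(1)]]],
        rule integrable_mult_Cc[OF absorption_locally_integrable test_fun_Cc[OF \<phi>]])
  have integrable_Basis: "integrable lborel (\<lambda>z. ?u z * dderiv [(b, 0), (b, 0)] \<phi> z)"
      "integrable lborel (\<lambda>z. ?g b z * dderiv [(b, 0)] \<phi> z)" if "b \<in> Basis" for b
    unfolding second_derivative
    by (rule integrable_mult_Cc[OF u_locally_integrable]
        integrable_mult_Cc[OF locally_integrable_inner[OF g_locally_integrable]],
        intro test_fun_Cc test_fun_dderiv \<phi> Basis(2) that)+
  have by_parts: "(LINT z|lborel. ?u z * dderiv [(b, 0), (b, 0)] \<phi> z)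
      = - (LINT z|lborel. ?g b z * dderiv [(b, 0)] \<phi> z)" if "b \<in> Basis" for b
    unfolding second_derivative by (rule weak_gradient[OF dx_test[OF that] that])
  have "0 = (LINT z|lborel. - (?u z * dderiv [(0, 1)] \<phi> z)
      - (\<Sum>b\<in>Basis. ?u z * dderiv [(b, 0), (b, 0)] \<phi> z) + absorption z * \<phi> z)"
    using weak_equation[OF \<phi>] by (simp add: absorption_def sum_distrib_left)
  also have "\<dots> = - (LINT z|lborel. ?u z * dderiv [(0, 1)] \<phi> z)
      + (\<Sum>b\<in>Basis. LINT z|lborel. ?g b z * dderiv [(b, 0)] \<phi> z) + (LINT z|lborel. absorption z * \<phi> z)"
    using integrable integrable_Basis by (simp add: by_parts sum_negf)
  finally show ?thesis
    using integrable integrable_Basis by simp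
qed

lemma weak_form_product:
  assumes \<xi>: "test_fun \<Omega> \<xi>" and \<theta>: "test_fun (tint T) \<theta>"
  shows "(LINT t|lborel. pairing t \<xi> * dderiv [1] \<theta> t) = (LINT z|lborel. dissipation \<xi> z * \<theta> (snd z))"
proof -
  let ?\<phi> = "\<lambda>z. \<xi> (fst z) * \<theta> (snd z)"
  have \<phi>: "test_fun (cyl \<Omega> T) ?\<phi>"
    unfolding cyl_def by (rule test_fun_product[OF \<xi> \<theta>])
  note smooth = test_fun_smooth[OF \<xi>] test_fun_smooth[OF \<theta>]
  have dt_\<phi>: "dderiv [(0, 1)] ?\<phi> z = \<xi> (fst z) * dderiv [1] \<theta> (snd z)" for z
    using dderiv_product[OF smooth] dderiv_zero[OF smooth(1)] by simp
  have dx_\<phi>: "dderiv [(b, 0)] ?\<phi> z = dderiv [b] \<xi> (fst z) * \<theta> (snd z)" for b z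
    using dderiv_product[OF smooth] dderiv_zero[OF smooth(2)] by simp
  have "test_fun (cyl \<Omega> T) (dderiv [(0, 1)] ?\<phi>)"
    by (rule test_fun_dderiv[OF \<phi>]) (simp add: Basis_prod_def)
  from integrable_mult_Cc[OF u_locally_integrable test_fun_Cc[OF this]]
  have "integrable lborel (\<lambda>z. u (fst z) (snd z) * (\<xi> (fst z) * dderiv [1] \<theta> (snd z)))"
    by (simp add: dt_\<phi>)
  then have "(LINT t|lborel. LINT x|lborel. u x t * (\<xi> x * dderiv [1] \<theta> t))
      = (LINT z|lborel. u (fst z) (snd z) * (\<xi> (fst z) * dderiv [1] \<theta> (snd z)))"
    using lborel_pair.integral_snd[of "\<lambda>x t. u x t * (\<xi> x * dderiv [1] \<theta> t)"]
    by (simp add: lborel_prod case_prod_beta')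
  moreover have "(LINT x|lborel. u x t * (\<xi> x * dderiv [1] \<theta> t)) = pairing t \<xi> * dderiv [1] \<theta> t" for t
    by (simp add: pairing_def mult.assoc[symmetric])
  ultimately have "(LINT t|lborel. pairing t \<xi> * dderiv [1] \<theta> t)
      = (LINT z|lborel. u (fst z) (snd z) * dderiv [(0, 1)] ?\<phi> z)"
    by (simp add: dt_\<phi>)
  also have "\<dots> = (LINT z|lborel. dissipation \<xi> z * \<theta> (snd z))"
    unfolding weak_form_gradient[OF \<phi>]
    by (simp add: dx_\<phi> dissipation_def distrib_right sum_distrib_right mult.assoc)
  finally show ?thesis .
qed

lemma dissipation_support:
  assumes "compact K" "\<And>x. x \<notin> K \<Longrightarrow> \<xi> x = 0"
  shows "set_integrable lborel (UNIV \<times> S) (dissipation \<xi>)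
      \<longleftrightarrow> set_integrable lborel (K \<times> S) (dissipation \<xi>)"
    and "(LINT z:UNIV \<times> S|lborel. dissipation \<xi> z) = (LINT z:K \<times> S|lborel. dissipation \<xi> z)"
proof -
  have "indicator (UNIV \<times> S) z *\<^sub>R dissipation \<xi> z = indicator (K \<times> S) z *\<^sub>R dissipation \<xi> z" for z
  proof (cases "fst z \<in> K")
    case False
    then have "dderiv [b] \<xi> (fst z) = 0" for b
      using assms by (intro dderiv_locally_const[of "- K" _ _ 0]) (auto simp: compact_imp_closed)
    with False show ?thesis
      using assms(2) by (simp add: dissipation_def)
  qed (simp add: indicator_def mem_Times_iff)
  then show "set_integrable lborel (UNIV \<times> S) (dissipation \<xi>)
      \<longleftrightarrow> set_integrable lborel (K \<times> S) (dissipation \<xi>)"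
    "(LINT z:UNIV \<times> S|lborel. dissipation \<xi> z) = (LINT z:K \<times> S|lborel. dissipation \<xi> z)"
    by (simp_all only: set_integrable_def set_lebesgue_integral_def)
qed

lemma cylinder_subset: "K \<subseteq> \<Omega> \<Longrightarrow> {a..b} \<subseteq> tint T \<Longrightarrow> K \<times> {a..b} \<subseteq> cyl \<Omega> T"
  unfolding cyl_def by (rule Sigma_mono)

lemma set_integrable_dissipation:
  assumes \<xi>: "test_fun \<Omega> \<xi>" and "{a..b} \<subseteq> tint T"
  shows "set_integrable lborel (UNIV \<times> {a..b}) (dissipation \<xi>)"
proof -
  obtain K where K: "compact K" "K \<subseteq> \<Omega>" "\<And>x. x \<notin> K \<Longrightarrow> \<xi> x = 0"
    using CcE[OF test_fun_Cc[OF \<xi>]] by blast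
  have cylinder: "compact (K \<times> {a..b})" "K \<times> {a..b} \<subseteq> cyl \<Omega> T"
    by (rule compact_Times[OF K(1) compact_Icc], rule cylinder_subset[OF K(2) assms(2)])
  have continuous_fst: "continuous_on UNIV (\<lambda>z::'a \<times> real. h (fst z))" if "smooth h" for h :: "'a \<Rightarrow> real"
    by (rule smooth_continuous_on[OF smooth_compose_bounded_linear[OF that bounded_linear_fst]])
  have "set_integrable lborel (K \<times> {a..b}) (\<lambda>z. (g (fst z) (snd z) \<bullet> i) * dderiv [i] \<xi> (fst z))"
    if "i \<in> Basis" for i
    by (intro set_integrable_mult_continuous cylinder continuous_fst smooth_dderiv test_fun_smooth[OF \<xi>]
        that locally_integrable_onD[OF locally_integrable_inner[OF g_locally_integrable]])
  moreover have "set_integrable lborel (K \<times> {a..b}) (\<lambda>z. absorption z * \<xi> (fst z))"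
    by (intro set_integrable_mult_continuous cylinder continuous_fst test_fun_smooth[OF \<xi>]
        locally_integrable_onD[OF absorption_locally_integrable])
  ultimately have "set_integrable lborel (K \<times> {a..b}) (dissipation \<xi>)"
    unfolding dissipation_def[abs_def] set_integrable_def scaleR_add_right scaleR_sum_right
    by (intro Bochner_Integration.integrable_add Bochner_Integration.integrable_sum)
  then show ?thesis
    by (simp add: dissipation_support(1)[OF K(1,3)])
qed

lemma set_integrable_dissipation_support:
  assumes "test_fun \<Omega> \<xi>" "compact K" "0 < s" "t \<in> tint T"
  shows "set_integrable lborel (K \<times> {s<..t}) (dissipation \<xi>)"
  using set_integrable_dissipation[OF assms(1) Icc_subset_tint[OF assms(3,4)]]
  by (rule set_integrable_subset[OF _ slab_measurable[OF borel_compact[OF assms(2)]]]) auto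

lemma pairing_increment:
  assumes "test_fun \<Omega> \<xi>" "0 < s" "s \<le> t" "t \<in> tint T"
  shows "pairing s \<xi> - pairing t \<xi> = (LINT z:UNIV \<times> {s<..t}|lborel. dissipation \<xi> z)"
  by (rule weak_derivative_increment[OF continuous_on_pairing[OF test_fun_Cc[OF assms(1)]]
        set_integrable_dissipation[OF assms(1)] weak_form_product[OF assms(1)] open_tint assms(3)
        Icc_subset_tint[OF assms(2,4)]])

lemma pairing_increment_support:
  assumes "test_fun \<Omega> \<xi>" "compact K" "\<And>x. x \<notin> K \<Longrightarrow> \<xi> x = 0" "0 < s" "s \<le> t" "t \<in> tint T"
  shows "pairing s \<xi> - pairing t \<xi> = (LINT z:K \<times> {s<..t}|lborel. dissipation \<xi> z)"
  using pairing_increment[OF assms(1,4-6)] dissipation_support(2)[OF assms(2,3)] by simp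

end

lemma nonneg_weak_solution_exists:
  assumes "1 < q" "open \<Omega>" "0 < T" "weak_solution q \<Omega> T u" "\<forall>x\<in>\<Omega>. \<forall>t\<in>tint T. 0 \<le> u x t"
  obtains g where "nonneg_weak_solution q \<Omega> T u g"
proof -
  note slice = conjunct1[OF assms(4)[unfolded weak_solution_def]]
  obtain g :: "'a \<Rightarrow> real \<Rightarrow> 'a" where
    integrable: "\<forall>K. compact K \<and> K \<subseteq> cyl \<Omega> T \<longrightarrow>
        set_integrable lborel K (\<lambda>z. u (fst z) (snd z)) \<and>
        set_integrable lborel K (\<lambda>z. g (fst z) (snd z)) \<and>
        set_integrable lborel K (\<lambda>z. norm (g (fst z) (snd z)) powr q)"
    and gradient: "\<forall>\<phi> b. test_fun (cyl \<Omega> T) \<phi> \<and> b \<in> Basis \<longrightarrow>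
        (LINT z|lborel. u (fst z) (snd z) * dderiv [(b, 0)] \<phi> z)
          = - (LINT z|lborel. (g (fst z) (snd z) \<bullet> b) * \<phi> z)"
    and equation: "\<forall>\<phi>. test_fun (cyl \<Omega> T) \<phi> \<longrightarrow>
        (LINT z|lborel. - u (fst z) (snd z) * dderiv [(0, 1)] \<phi> z
            - u (fst z) (snd z) * (\<Sum>b\<in>Basis. dderiv [(b, 0), (b, 0)] \<phi> z)
            + norm (g (fst z) (snd z)) powr q * \<phi> z) = 0"
    using conjunct2[OF assms(4)[unfolded weak_solution_def]] by (elim exE conjE)
  have "nonneg_weak_solution q \<Omega> T u g"
    by unfold_locales
      (use assms(1-3,5) slice integrable gradient equation in \<open>auto simp: locally_integrable_on_def\<close>)
  then show ?thesis
    by (rule that)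
qed

section \<open>Regular and singular points\<close>

lemma dderiv_power_Suc:
  assumes "smooth \<eta>"
  shows "dderiv [b] (\<lambda>x. \<eta> x ^ Suc n) x = real (Suc n) * \<eta> x ^ n * dderiv [b] \<eta> x"
proof -
  have "(\<eta> has_derivative frechet_derivative \<eta> (at x)) (at x)"
    using smooth_differentiable[OF assms] by (simp add: frechet_derivative_works)
  from dderiv_eqI[OF has_derivative_power[OF this, of "Suc n"], of b] show ?thesis
    by (simp add: dderiv_singleton mult_ac)
qed

lemma sum_abs_dderiv_bounded:
  fixes \<xi> :: "'a::euclidean_space \<Rightarrow> real"
  assumes "test_fun A \<xi>"
  obtains B where "0 \<le> B" "\<And>x. (\<Sum>b\<in>Basis. \<bar>dderiv [b] \<xi> x\<bar>) \<le> B"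
proof -
  have "\<exists>B. \<forall>x. \<bar>dderiv [b] \<xi> x\<bar> \<le> B" if "b \<in> Basis" for b
    using Cc_bounded[OF test_fun_Cc[OF test_fun_dderiv[OF assms that]]] by blast
  then obtain B where B: "\<And>b x. b \<in> Basis \<Longrightarrow> \<bar>dderiv [b] \<xi> x\<bar> \<le> B b"
    by metis
  show ?thesis
  proof (rule that[of "\<Sum>b\<in>Basis. B b"])
    show "0 \<le> (\<Sum>b\<in>Basis. B b)"
      using B by (intro sum_nonneg) (meson abs_ge_zero order_trans)
  qed (intro sum_mono B)
qed

lemma abs_sum_inner_Basis_le:
  fixes v :: "'a::euclidean_space"
  shows "\<bar>\<Sum>b\<in>Basis. (v \<bullet> b) * d b\<bar> \<le> norm v * (\<Sum>b\<in>Basis. \<bar>d b\<bar>)"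
proof -
  have "\<bar>\<Sum>b\<in>Basis. (v \<bullet> b) * d b\<bar> \<le> (\<Sum>b\<in>Basis. \<bar>(v \<bullet> b) * d b\<bar>)"
    by (rule sum_abs)
  also have "\<dots> \<le> (\<Sum>b\<in>Basis. norm v * \<bar>d b\<bar>)"
    by (intro sum_mono) (simp add: abs_mult mult_right_mono Basis_le_norm)
  finally show ?thesis
    by (simp add: sum_distrib_left)
qed

text \<open>
  The condition on \<open>n\<close> keeps the exponent of \<open>e\<close> nonnegative in the second factor of Young's inequality.
\<close>
lemma young_absorption:
  fixes q :: real
  assumes "1 < q" "0 \<le> C" "0 \<le> a" "0 \<le> e" "e \<le> 1" "1 / (q - 1) \<le> real n"
  shows "C * a * e ^ n \<le> a powr q * e ^ Suc n / q + C powr (q / (q - 1)) / (q / (q - 1))"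
proof (cases "e = 0")
  case True
  have "0 < n"
    using assms(1,6) by (intro Nat.gr0I) auto
  with True show ?thesis
    using assms(1) by (simp add: zero_power)
next
  case False
  let ?p = "q / (q - 1)"
  have e: "0 < e"
    using False \<open>0 \<le> e\<close> by simp
  define x where "x = a * e powr (real (Suc n) / q)"
  define y where "y = C * e powr (real n - real (Suc n) / q)"
  have "e powr (real (Suc n) / q) * e powr (real n - real (Suc n) / q) = e ^ n"
    using e by (simp add: powr_add[symmetric] powr_realpow)
  then have "C * a * e ^ n = x * y"
    by (simp add: x_def y_def mult_ac)
  also have "x * y \<le> x powr q / q + y powr ?p / ?p"
    using assms by (intro Youngs_inequality) (auto simp: x_def y_def field_simps)
  also have "x powr q = a powr q * e ^ Suc n"
    using assms(1,3) e by (simp add: x_def powr_mult powr_powr powr_realpow[symmetric] del: power_Suc)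
  also have "y powr ?p \<le> C powr ?p"
  proof (rule powr_mono2)
    have "real (Suc n) / q \<le> real n"
      using assms(1,6) by (simp add: field_simps)
    then have "e powr (real n - real (Suc n) / q) \<le> 1"
      using e \<open>e \<le> 1\<close> by (intro powr_le1) auto
    then show "y \<le> C"
      using assms(2) by (simp add: y_def mult_left_le)
  qed (use assms in \<open>auto simp: y_def\<close>)
  finally show ?thesis
    using assms(1) by (simp add: divide_right_mono)
qed

context nonneg_weak_solution
begin

definition finite_absorption :: "'a set \<Rightarrow> bool" where
  "finite_absorption A \<longleftrightarrow> (\<exists>\<tau>\<in>tint T. set_integrable lborel (A \<times> {0<..\<tau>}) absorption)"

definition regular_set :: "'a set" where
  "regular_set = \<Union>{U. open U \<and> U \<subseteq> \<Omega> \<and> finite_absorption U}"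

lemma open_regular_set: "open regular_set"
  unfolding regular_set_def by (rule open_Union) blast

lemma regular_set_subset: "regular_set \<subseteq> \<Omega>"
  unfolding regular_set_def by blast

lemma set_integrable_absorption:
  assumes "compact K" "K \<subseteq> \<Omega>" "0 < s" "\<tau> \<in> tint T"
  shows "set_integrable lborel (K \<times> {s<..\<tau>}) absorption"
proof (rule set_integrable_subset[OF _ slab_measurable[OF borel_compact[OF assms(1)]]])
  show "set_integrable lborel (K \<times> {s..\<tau>}) absorption"
    by (rule locally_integrable_onD[OF absorption_locally_integrable compact_Times[OF assms(1) compact_Icc]
          cylinder_subset[OF assms(2) Icc_subset_tint[OF assms(3,4)]]])
qed auto

lemma finite_absorption_empty: "finite_absorption {}"
  unfolding finite_absorption_def using tint_nonempty[OF T_pos] by (auto simp: set_integrable_def)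

lemma finite_absorption_subset:
  assumes "finite_absorption B" "A \<in> sets borel" "A \<subseteq> B"
  shows "finite_absorption A"
  using assms(1) set_integrable_subset[OF _ slab_measurable[OF assms(2)] Sigma_mono[OF assms(3) order_refl]]
  unfolding finite_absorption_def by blast

lemma not_finite_absorption_singular:
  assumes "x0 \<notin> regular_set" "0 < r" "cball x0 r \<subseteq> \<Omega>"
  shows "\<not> finite_absorption (cball x0 r)"
proof
  assume "finite_absorption (cball x0 r)"
  then have "finite_absorption (ball x0 r)"
    by (rule finite_absorption_subset) auto
  moreover have "ball x0 r \<subseteq> \<Omega>"
    using assms(3) ball_subset_cball by blast
  ultimately have "ball x0 r \<subseteq> regular_set"
    unfolding regular_set_def by blast
  then show False
    using assms(1,2) centre_in_ball[of x0 r] by blast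
qed

lemma finite_absorption_Un:
  assumes "finite_absorption A" "finite_absorption B" "A \<in> sets borel" "B \<in> sets borel"
  shows "finite_absorption (A \<union> B)"
proof -
  obtain \<tau> \<tau>' where \<tau>: "\<tau> \<in> tint T" "set_integrable lborel (A \<times> {0<..\<tau>}) absorption"
    and \<tau>': "\<tau>' \<in> tint T" "set_integrable lborel (B \<times> {0<..\<tau>'}) absorption"
    using assms(1,2) unfolding finite_absorption_def by blast
  have "set_integrable lborel (A \<times> {0<..min \<tau> \<tau>'}) absorption"
    by (rule set_integrable_subset[OF \<tau>(2) slab_measurable[OF assms(3)]]) auto
  moreover have "set_integrable lborel (B \<times> {0<..min \<tau> \<tau>'}) absorption"
    by (rule set_integrable_subset[OF \<tau>'(2) slab_measurable[OF assms(4)]]) auto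
  ultimately have "set_integrable lborel ((A \<union> B) \<times> {0<..min \<tau> \<tau>'}) absorption"
    unfolding Sigma_Un_distrib1 using assms(3,4) by (intro set_integrable_Un slab_measurable)
  moreover have "min \<tau> \<tau>' \<in> tint T"
    using \<tau>(1) \<tau>'(1) by (simp add: min_def)
  ultimately show ?thesis
    unfolding finite_absorption_def by blast
qed

lemma finite_absorption_compact:
  assumes "compact K" "K \<subseteq> regular_set"
  shows "finite_absorption K"
proof -
  obtain \<U> where \<U>: "\<U> \<subseteq> {U. open U \<and> U \<subseteq> \<Omega> \<and> finite_absorption U}" "finite \<U>" "K \<subseteq> \<Union>\<U>"
    by (rule compactE[OF assms(1) assms(2)[unfolded regular_set_def]]) auto
  from \<U>(2,1) have "finite_absorption (\<Union>\<U>)"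
  proof induction
    case (insert U \<U>)
    then have "open U" "finite_absorption U" "open (\<Union>\<U>)"
      by auto
    with insert show ?case
      by (simp add: finite_absorption_Un borel_open)
  qed (simp add: finite_absorption_empty)
  then show ?thesis
    using \<U>(3) borel_compact[OF assms(1)] finite_absorption_subset by blast
qed

lemma abs_dissipation_le:
  assumes "test_fun \<Omega> \<xi>"
  obtains C where "\<And>z. \<bar>dissipation \<xi> z\<bar> \<le> C + C * absorption z"
proof -
  obtain B where B: "0 \<le> B" "\<And>x. (\<Sum>b\<in>Basis. \<bar>dderiv [b] \<xi> x\<bar>) \<le> B"
    using sum_abs_dderiv_bounded[OF assms] by blast
  obtain B' where B': "0 < B'" "\<And>x. \<bar>\<xi> x\<bar> \<le> B'"
    using Cc_bounded[OF test_fun_Cc[OF assms]] by blast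
  have "\<bar>dissipation \<xi> z\<bar> \<le> (B + B') + (B + B') * absorption z" for z
  proof -
    let ?a = "norm (g (fst z) (snd z))"
    have a_le: "?a \<le> 1 + absorption z"
    proof (cases "?a \<le> 1")
      case False
      then show ?thesis
        using powr_mono[of 1 q ?a] q_gt_1 by (simp add: absorption_def)
    qed (simp add: add_increasing2 absorption_nonneg)
    have "\<bar>dissipation \<xi> z\<bar> \<le> ?a * (\<Sum>b\<in>Basis. \<bar>dderiv [b] \<xi> (fst z)\<bar>) + absorption z * \<bar>\<xi> (fst z)\<bar>"
      unfolding dissipation_def
      by (intro order_trans[OF abs_triangle_ineq] add_mono abs_sum_inner_Basis_le)
        (simp add: abs_mult absorption_nonneg)
    also have "\<dots> \<le> (1 + absorption z) * B + absorption z * B'"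
      using a_le B B' absorption_nonneg
      by (intro add_mono mult_mono mult_left_mono) (auto intro: sum_nonneg)
    finally show ?thesis
      using B' by (simp add: algebra_simps)
  qed
  then show ?thesis
    by (rule that)
qed

lemma set_integrable_dissipation_initial:
  assumes \<xi>: "test_fun \<Omega> \<xi>" and K: "compact K" "K \<subseteq> \<Omega>" "\<And>x. x \<notin> K \<Longrightarrow> \<xi> x = 0"
    and "\<tau> \<in> tint T" "set_integrable lborel (K \<times> {0<..\<tau>}) absorption"
  shows "set_integrable lborel (UNIV \<times> {0<..\<tau>}) (dissipation \<xi>)"
proof -
  obtain C where C: "\<And>z. \<bar>dissipation \<xi> z\<bar> \<le> C + C * absorption z"
    using abs_dissipation_le[OF \<xi>] by blast
  have "set_integrable lborel (K \<times> {0<..\<tau>}) (\<lambda>z. C + C * absorption z)"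
    using assms(6) by (intro set_integral_add(1) set_integrable_const_slab K(1)) simp
  then have "set_integrable lborel (K \<times> {0<..\<tau>}) (dissipation \<xi>)"
  proof (rule set_integrable_bound)
    show "set_borel_measurable lborel (K \<times> {0<..\<tau>}) (dissipation \<xi>)"
    proof (rule set_borel_measurable_slab)
      fix s :: real assume "0 < s"
      then show "set_borel_measurable lborel (K \<times> {s<..\<tau>}) (dissipation \<xi>)"
        using set_integrable_dissipation_support[OF \<xi> K(1) _ assms(5)]
        by (auto simp: set_integrable_def set_borel_measurable_def)
    qed
    show "AE z in lborel. z \<in> K \<times> {0<..\<tau>} \<longrightarrow> norm (dissipation \<xi> z) \<le> norm (C + C * absorption z)"
      using C by (auto intro: order_trans[OF _ abs_ge_self])
  qed
  then show ?thesis
    by (simp add: dissipation_support(1)[OF K(1,3)])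
qed

lemma pairing_convergent:
  assumes "test_fun regular_set \<xi>"
  shows "\<exists>l. ((\<lambda>s. pairing s \<xi>) \<longlongrightarrow> l) (at_right 0)"
proof -
  have \<xi>: "test_fun \<Omega> \<xi>"
    by (rule test_fun_mono[OF assms regular_set_subset])
  obtain K where K: "compact K" "K \<subseteq> regular_set" "\<And>x. x \<notin> K \<Longrightarrow> \<xi> x = 0"
    using CcE[OF test_fun_Cc[OF assms]] by blast
  obtain \<tau> where \<tau>: "\<tau> \<in> tint T" "set_integrable lborel (K \<times> {0<..\<tau>}) absorption"
    using finite_absorption_compact[OF K(1,2)] unfolding finite_absorption_def by blast
  have "set_integrable lborel (UNIV \<times> {0<..\<tau>}) (dissipation \<xi>)"
    using K(2) regular_set_subset by (intro set_integrable_dissipation_initial[OF \<xi> K(1) _ K(3) \<tau>]) auto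
  then have "((\<lambda>s. pairing \<tau> \<xi> + (LINT z:UNIV \<times> {s<..\<tau>}|lborel. dissipation \<xi> z))
      \<longlongrightarrow> pairing \<tau> \<xi> + (LINT z:UNIV \<times> {0<..\<tau>}|lborel. dissipation \<xi> z)) (at_right 0)"
    by (intro tendsto_intros tendsto_slab_integral) auto
  moreover have "\<forall>\<^sub>F s in at_right 0.
      pairing \<tau> \<xi> + (LINT z:UNIV \<times> {s<..\<tau>}|lborel. dissipation \<xi> z) = pairing s \<xi>"
    unfolding eventually_at_right_field
    using \<tau>(1) pairing_increment[OF \<xi> _ _ \<tau>(1), symmetric] by (intro exI[of _ \<tau>]) (auto simp: tint_def)
  ultimately show ?thesis
    by (intro exI) (rule Lim_transform_eventually)
qed

lemma initial_trace:
  obtains \<mu> where "radon_pos_on regular_set \<mu>"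
    and "\<And>\<psi>. \<psi> \<in> Cc regular_set \<Longrightarrow> ((\<lambda>t. pairing t \<psi>) \<longlongrightarrow> integral\<^sup>L \<mu> \<psi>) (at_right 0)"
proof (rule vague_limit_exists[OF open_regular_set, of "at_right 0" pairing])
  show "\<forall>\<^sub>F t in at_right 0. positive_functional regular_set (pairing t)"
    using eventually_tint[OF T_pos]
    by eventually_elim
      (rule positive_functional_restrict[OF positive_functional_pairing open_regular_set
          regular_set_subset])
qed (simp, erule pairing_convergent, rule that)

lemma dissipation_power_lower_bound:
  assumes \<eta>: "test_fun \<Omega> \<eta>" "\<And>x. 0 \<le> \<eta> x" "\<And>x. \<eta> x \<le> 1" and "1 / (q - 1) \<le> real n"
  obtains C where "0 \<le> C"
    "\<And>z. (1 - 1 / q) * (absorption z * \<eta> (fst z) ^ Suc n) \<le> dissipation (\<lambda>x. \<eta> x ^ Suc n) z + C"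
proof -
  let ?\<xi> = "\<lambda>x. \<eta> x ^ Suc n"
  obtain B where B: "0 \<le> B" "\<And>x. (\<Sum>b\<in>Basis. \<bar>dderiv [b] \<eta> x\<bar>) \<le> B"
    using sum_abs_dderiv_bounded[OF \<eta>(1)] by blast
  define C where "C = (real (Suc n) * B) powr (q / (q - 1)) / (q / (q - 1))"
  have "0 \<le> C"
    using q_gt_1 by (simp add: C_def)
  moreover have "(1 - 1 / q) * (absorption z * ?\<xi> (fst z)) \<le> dissipation ?\<xi> z + C" for z
  proof -
    let ?a = "norm (g (fst z) (snd z))"
    have "(\<Sum>b\<in>Basis. \<bar>dderiv [b] ?\<xi> (fst z)\<bar>)
        = real (Suc n) * \<eta> (fst z) ^ n * (\<Sum>b\<in>Basis. \<bar>dderiv [b] \<eta> (fst z)\<bar>)"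
      unfolding dderiv_power_Suc[OF test_fun_smooth[OF \<eta>(1)]] sum_distrib_left
      using \<eta>(2) by (simp add: abs_mult)
    also have "\<dots> \<le> real (Suc n) * \<eta> (fst z) ^ n * B"
      using \<eta>(2) by (intro mult_left_mono B(2)) auto
    finally have "?a * (\<Sum>b\<in>Basis. \<bar>dderiv [b] ?\<xi> (fst z)\<bar>) \<le> ?a * (real (Suc n) * \<eta> (fst z) ^ n * B)"
      by (rule mult_left_mono) simp
    also have "\<dots> = (real (Suc n) * B) * ?a * \<eta> (fst z) ^ n"
      by (simp only: mult_ac)
    also have "\<dots> \<le> absorption z * ?\<xi> (fst z) / q + C"
      unfolding absorption_def C_def using q_gt_1 B(1) \<eta>(2,3) assms(4) by (intro young_absorption) auto
    finally show ?thesis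
      using abs_sum_inner_Basis_le[of "g (fst z) (snd z)" "\<lambda>b. dderiv [b] ?\<xi> (fst z)"]
      unfolding dissipation_def left_diff_distrib by simp
  qed
  ultimately show ?thesis
    by (rule that)
qed

lemma pairing_lower_bound:
  assumes \<xi>: "test_fun \<Omega> \<xi>" "\<And>x. 0 \<le> \<xi> x" and K: "compact K" "K \<subseteq> \<Omega>" "\<And>x. x \<notin> K \<Longrightarrow> \<xi> x = 0"
    and B: "compact B" "B \<subseteq> K" "\<And>x. x \<in> B \<Longrightarrow> c \<le> \<xi> x" and "0 \<le> \<kappa>" "0 \<le> C"
    and coercive: "\<And>z. \<kappa> * (absorption z * \<xi> (fst z)) \<le> dissipation \<xi> z + C"
    and s: "0 < s" "s \<le> \<tau>" "\<tau> \<in> tint T"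
  shows "\<kappa> * c * (LINT z:B \<times> {s<..\<tau>}|lborel. absorption z)
    \<le> pairing s \<xi> - pairing \<tau> \<xi> + (LINT z:K \<times> {0<..\<tau>}|lborel. C)"
proof -
  note integrable = set_integrable_dissipation_support[OF \<xi>(1) K(1) s(1,3)]
  have "B \<subseteq> \<Omega>"
    using B(2) K(2) by blast
  have "\<kappa> * c * (LINT z:B \<times> {s<..\<tau>}|lborel. absorption z)
      = (LINT z|lborel. indicator (B \<times> {s<..\<tau>}) z *\<^sub>R (\<kappa> * c * absorption z))"
    by (simp add: set_lebesgue_integral_def mult.left_commute)
  also have "\<dots> \<le> (LINT z|lborel. indicator (K \<times> {s<..\<tau>}) z *\<^sub>R (dissipation \<xi> z + C))"
  proof (rule integral_mono)
    show "integrable lborel (\<lambda>z. indicator (B \<times> {s<..\<tau>}) z *\<^sub>R (\<kappa> * c * absorption z))"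
      using set_integrable_absorption[OF B(1) \<open>B \<subseteq> \<Omega>\<close> s(1,3)]
      by (simp add: set_integrable_def mult.left_commute)
    show "integrable lborel (\<lambda>z. indicator (K \<times> {s<..\<tau>}) z *\<^sub>R (dissipation \<xi> z + C))"
      using set_integral_add(1)[OF integrable set_integrable_const_slab[OF K(1)]]
      by (simp add: set_integrable_def)
    fix z :: "'a \<times> real"
    have nonneg: "0 \<le> dissipation \<xi> z + C"
      using coercive[of z] \<xi>(2) absorption_nonneg \<open>0 \<le> \<kappa>\<close>
      by (intro order_trans[OF mult_nonneg_nonneg coercive]) auto
    have "\<kappa> * c * absorption z \<le> dissipation \<xi> z + C" if "fst z \<in> B"
    proof -
      have "\<kappa> * (absorption z * c) \<le> \<kappa> * (absorption z * \<xi> (fst z))"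
        using B(3)[OF that] absorption_nonneg \<open>0 \<le> \<kappa>\<close> by (intro mult_left_mono) auto
      with coercive[of z] show ?thesis
        by (simp add: mult_ac)
    qed
    with nonneg show "indicator (B \<times> {s<..\<tau>}) z *\<^sub>R (\<kappa> * c * absorption z)
        \<le> indicator (K \<times> {s<..\<tau>}) z *\<^sub>R (dissipation \<xi> z + C)"
      using B(2) by (auto simp: indicator_def mem_Times_iff)
  qed
  also have "\<dots> = (LINT z:K \<times> {s<..\<tau>}|lborel. dissipation \<xi> z) + (LINT z:K \<times> {s<..\<tau>}|lborel. C)"
    using set_integral_add(2)[OF integrable set_integrable_const_slab[OF K(1)]]
    by (simp add: set_lebesgue_integral_def)
  also have "(LINT z:K \<times> {s<..\<tau>}|lborel. dissipation \<xi> z) = pairing s \<xi> - pairing \<tau> \<xi>"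
    by (rule pairing_increment_support[OF \<xi>(1) K(1,3) s, symmetric])
  also have "(LINT z:K \<times> {s<..\<tau>}|lborel. C) \<le> (LINT z:K \<times> {0<..\<tau>}|lborel. C)"
    unfolding set_lebesgue_integral_def
    using set_integrable_const_slab[OF K(1), of _ \<tau> C] \<open>0 < s\<close> \<open>0 \<le> C\<close>
    by (intro integral_mono) (auto simp: set_integrable_def indicator_def)
  finally show ?thesis
    by simp
qed

lemma pairing_at_top:
  assumes \<xi>: "test_fun \<Omega> \<xi>" "\<And>x. 0 \<le> \<xi> x" and K: "compact K" "K \<subseteq> \<Omega>" "\<And>x. x \<notin> K \<Longrightarrow> \<xi> x = 0"
    and B: "compact B" "B \<subseteq> K" "\<And>x. x \<in> B \<Longrightarrow> c \<le> \<xi> x" and "0 < c" "0 < \<kappa>" "0 \<le> C"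
    and coercive: "\<And>z. \<kappa> * (absorption z * \<xi> (fst z)) \<le> dissipation \<xi> z + C"
    and singular: "\<not> finite_absorption B"
  shows "LIM s at_right 0. pairing s \<xi> :> at_top"
proof -
  obtain \<tau> where \<tau>: "\<tau> \<in> tint T"
    using tint_nonempty[OF T_pos] .
  let ?I = "\<lambda>s. LINT z:B \<times> {s<..\<tau>}|lborel. absorption z"
  have "\<not> set_integrable lborel (B \<times> {0<..\<tau>}) absorption"
    using \<tau> singular unfolding finite_absorption_def by blast
  then have "LIM s at_right 0. ?I s :> at_top"
    using B(1,2) K(2) \<tau>
    by (intro slab_integral_at_top set_integrable_absorption absorption_nonneg borel_compact) auto
  then have "LIM s at_right 0. (pairing \<tau> \<xi> - (LINT z:K \<times> {0<..\<tau>}|lborel. C)) + \<kappa> * c * ?I s :> at_top"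
    using \<open>0 < c\<close> \<open>0 < \<kappa>\<close>
    by (intro filterlim_tendsto_add_at_top[OF tendsto_const]
        filterlim_tendsto_pos_mult_at_top[OF tendsto_const]) auto
  moreover have "\<forall>\<^sub>F s in at_right 0.
      (pairing \<tau> \<xi> - (LINT z:K \<times> {0<..\<tau>}|lborel. C)) + \<kappa> * c * ?I s \<le> pairing s \<xi>"
    unfolding eventually_at_right_field
  proof (intro exI[of _ \<tau>] conjI allI impI)
    show "0 < \<tau>"
      using \<tau> by (simp add: tint_def)
    fix s :: real assume "0 < s" "s < \<tau>"
    then have "\<kappa> * c * ?I s \<le> pairing s \<xi> - pairing \<tau> \<xi> + (LINT z:K \<times> {0<..\<tau>}|lborel. C)"
      using \<open>0 < \<kappa>\<close> \<tau> by (intro pairing_lower_bound[OF \<xi> K B _ \<open>0 \<le> C\<close> coercive]) auto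
    then show "(pairing \<tau> \<xi> - (LINT z:K \<times> {0<..\<tau>}|lborel. C)) + \<kappa> * c * ?I s \<le> pairing s \<xi>"
      by simp
  qed
  ultimately show ?thesis
    by (rule filterlim_at_top_mono)
qed

lemma coercive_cutoff:
  assumes "0 < r" "cball x0 r \<subseteq> \<Omega>"
  obtains \<xi> C where "test_fun \<Omega> \<xi>" "\<And>x. 0 \<le> \<xi> x" "\<And>x. \<xi> x \<le> 1" "\<And>x. \<xi> x = 0 \<longleftrightarrow> x \<notin> ball x0 r"
    and "0 \<le> C" "\<And>z. (1 - 1 / q) * (absorption z * \<xi> (fst z)) \<le> dissipation \<xi> z + C"
proof -
  obtain \<eta> where \<eta>: "test_fun \<Omega> \<eta>" "\<And>x. 0 \<le> \<eta> x" "\<And>x. \<eta> x \<le> 1" "\<And>x. \<eta> x = 0 \<longleftrightarrow> x \<notin> ball x0 r"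
    using test_fun_bump[OF assms] by metis
  obtain n :: nat where n: "1 / (q - 1) \<le> real n"
    using real_arch_simple by blast
  obtain C where C: "0 \<le> C"
      "\<And>z. (1 - 1 / q) * (absorption z * \<eta> (fst z) ^ Suc n) \<le> dissipation (\<lambda>x. \<eta> x ^ Suc n) z + C"
    using dissipation_power_lower_bound[OF \<eta>(1-3) n] by blast
  show ?thesis
  proof (rule that[OF test_fun_power_Suc[OF \<eta>(1), of n] _ _ _ C])
    show "0 \<le> \<eta> x ^ Suc n" "\<eta> x ^ Suc n \<le> 1" for x
      using \<eta>(2,3) by (auto intro: power_le_one simp del: power_Suc)
    show "\<eta> x ^ Suc n = 0 \<longleftrightarrow> x \<notin> ball x0 r" for x
      unfolding \<eta>(4)[symmetric] by auto
  qed
qed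

lemma singular_cutoff:
  assumes "x0 \<in> \<Omega> - regular_set" "0 < \<epsilon>"
  obtains \<xi> where "\<xi> \<in> Cc \<Omega>" "\<And>x. 0 \<le> \<xi> x" "\<And>x. \<xi> x \<le> indicator (ball x0 \<epsilon> \<inter> \<Omega>) x"
    "LIM s at_right 0. pairing s \<xi> :> at_top"
proof -
  have "open (ball x0 \<epsilon> \<inter> \<Omega>)" "x0 \<in> ball x0 \<epsilon> \<inter> \<Omega>"
    using open_\<Omega> assms by auto
  then obtain r where "0 < r" and r: "cball x0 r \<subseteq> ball x0 \<epsilon> \<inter> \<Omega>"
    using open_contains_cball by blast
  then have "cball x0 r \<subseteq> \<Omega>"
    by blast
  then obtain \<xi> C where \<xi>: "test_fun \<Omega> \<xi>" "\<And>x. 0 \<le> \<xi> x" "\<And>x. \<xi> x \<le> 1" "\<And>x. \<xi> x = 0 \<longleftrightarrow> x \<notin> ball x0 r"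
    and C: "0 \<le> C" "\<And>z. (1 - 1 / q) * (absorption z * \<xi> (fst z)) \<le> dissipation \<xi> z + C"
    using coercive_cutoff[OF \<open>0 < r\<close>, of x0] by metis
  let ?B = "cball x0 (r / 2)"
  have B: "?B \<subseteq> ball x0 r" "?B \<subseteq> cball x0 r" "?B \<subseteq> \<Omega>" "?B \<noteq> {}"
    using \<open>0 < r\<close> r by auto
  obtain y where y: "y \<in> ball x0 r" "\<And>x. x \<in> ?B \<Longrightarrow> \<xi> y \<le> \<xi> x"
    using continuous_attains_inf[OF compact_cball B(4) Cc_continuous_on[OF test_fun_Cc[OF \<xi>(1)]]] B(1)
    by blast
  have "\<xi> x \<le> indicator (ball x0 \<epsilon> \<inter> \<Omega>) x" for x
    using \<xi>(3)[of x] \<xi>(4)[of x] r ball_subset_cball[of x0 r]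
    by (cases "x \<in> ball x0 r") (auto simp only: subset_iff indicator_simps)
  moreover have "LIM s at_right 0. pairing s \<xi> :> at_top"
  proof (rule pairing_at_top[OF \<xi>(1,2) compact_cball \<open>cball x0 r \<subseteq> \<Omega>\<close> _ compact_cball B(2) y(2) _ _ C])
    show "\<xi> x = 0" if "x \<notin> cball x0 r" for x
      using \<xi>(4) that by simp
    show "0 < \<xi> y"
      using \<xi>(2)[of y] \<xi>(4)[of y] y(1) by (simp add: less_le)
    show "0 < 1 - 1 / q"
      using q_gt_1 by simp
    show "\<not> finite_absorption ?B"
      using assms(1) \<open>0 < r\<close> B(3) by (intro not_finite_absorption_singular) auto
  qed
  ultimately show ?thesis
    by (rule that[OF test_fun_Cc[OF \<xi>(1)] \<xi>(2)])
qed

lemma pairing_le_nn_integral: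
  assumes "\<xi> \<in> Cc \<Omega>" "\<And>x. 0 \<le> \<xi> x" "\<And>x. \<xi> x \<le> indicator A x" "A \<subseteq> \<Omega>" "t \<in> tint T"
  shows "ennreal (pairing t \<xi>) \<le> (\<integral>\<^sup>+ x. ennreal (u x t) * indicator A x \<partial>lborel)"
proof -
  have "ennreal (pairing t \<xi>) = (\<integral>\<^sup>+ x. ennreal (u x t * \<xi> x) \<partial>lborel)"
    unfolding pairing_def using nn_integral_eq_integral[OF integrable_pairing[OF assms(1,5)]]
      u_mult_nonneg[OF assms(1,2,5)] by simp
  also have "\<dots> \<le> (\<integral>\<^sup>+ x. ennreal (u x t) * indicator A x \<partial>lborel)"
  proof (rule nn_integral_mono)
    fix x
    show "ennreal (u x t * \<xi> x) \<le> ennreal (u x t) * indicator A x"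
    proof (cases "x \<in> A")
      case True
      then have "u x t * \<xi> x \<le> u x t"
        using assms(3)[of x] assms(4) u_nonneg[OF _ assms(5), of x] by (intro mult_left_le) auto
      with True show ?thesis
        by (simp add: ennreal_leI)
    next
      case False
      then have "\<xi> x = 0"
        using assms(2,3)[of x] by (simp add: order_antisym)
      then show ?thesis
        by simp
    qed
  qed
  finally show ?thesis .
qed

lemma blow_up_at_singular_points:
  assumes "x0 \<in> \<Omega> - regular_set" "0 < \<epsilon>"
  shows "((\<lambda>t. \<integral>\<^sup>+ x. ennreal (u x t) * indicator (ball x0 \<epsilon> \<inter> \<Omega>) x \<partial>lborel) \<longlongrightarrow> \<infinity>) (at_right 0)"
proof -
  obtain \<xi> where \<xi>: "\<xi> \<in> Cc \<Omega>" "\<And>x. 0 \<le> \<xi> x" "\<And>x. \<xi> x \<le> indicator (ball x0 \<epsilon> \<inter> \<Omega>) x"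
    and at_top: "LIM s at_right 0. pairing s \<xi> :> at_top"
    using singular_cutoff[OF assms] by blast
  have "\<forall>\<^sub>F t in at_right 0. ennreal l < (\<integral>\<^sup>+ x. ennreal (u x t) * indicator (ball x0 \<epsilon> \<inter> \<Omega>) x \<partial>lborel)"
    if "0 \<le> l" for l
    using filterlim_at_top_dense[THEN iffD1, OF at_top, rule_format, of l] eventually_tint[OF T_pos]
  proof eventually_elim
    case (elim t)
    have "ennreal l < ennreal (pairing t \<xi>)"
      using elim(1) that by (simp add: ennreal_less_iff)
    also have "\<dots> \<le> (\<integral>\<^sup>+ x. ennreal (u x t) * indicator (ball x0 \<epsilon> \<inter> \<Omega>) x \<partial>lborel)"
      by (rule pairing_le_nn_integral[OF \<xi> _ elim(2)]) simp
    finally show ?case .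
  qed
  then show ?thesis
    by (simp add: tendsto_top_iff_ennreal)
qed

lemma set_integral_eq_pairing:
  "(LINT x:A|lborel. u x t * \<psi> x) = pairing t (\<lambda>x. indicator A x *\<^sub>R \<psi> x)"
  by (simp add: pairing_def set_lebesgue_integral_def mult_ac)

end

theorem theorem1p1:
  fixes q :: real and \<Omega> :: "'a::euclidean_space set" and T :: ereal
    and u :: "'a \<Rightarrow> real \<Rightarrow> real"
  assumes "q > 1"
    and "open \<Omega>" and "connected \<Omega>" and "\<Omega> \<noteq> {}"
    and "T > 0"
    and "weak_solution q \<Omega> T u"
    and "\<forall>x\<in>\<Omega>. \<forall>t\<in>tint T. u x t \<ge> 0"
  shows "\<exists>S \<subseteq> \<Omega>. open (\<Omega> - S) \<and>
    (\<exists>u0. radon_pos_on (\<Omega> - S) u0 \<and>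
      (\<forall>\<psi>. Cc_on (\<Omega> - S) \<psi> \<longrightarrow>
         ((\<lambda>t. LINT x:(\<Omega> - S)|lborel. u x t * \<psi> x)
            \<longlongrightarrow> set_lebesgue_integral u0 (\<Omega> - S) \<psi>) (at_right 0)) \<and>
      (\<forall>x0\<in>S. \<forall>\<epsilon>>0.
         ((\<lambda>t. \<integral>\<^sup>+ x. ennreal (u x t) * indicator (ball x0 \<epsilon> \<inter> \<Omega>) x \<partial>lborel)
            \<longlongrightarrow> \<infinity>) (at_right 0)))"
proof -
  obtain g where "nonneg_weak_solution q \<Omega> T u g"
    using nonneg_weak_solution_exists[OF assms(1,2,5-7)] .
  then interpret nonneg_weak_solution q \<Omega> T u g .
  obtain u0 where u0: "radon_pos_on regular_set u0"
    "\<And>\<psi>. \<psi> \<in> Cc regular_set \<Longrightarrow> ((\<lambda>t. pairing t \<psi>) \<longlongrightarrow> integral\<^sup>L u0 \<psi>) (at_right 0)"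
    using initial_trace by blast
  have "((\<lambda>t. LINT x:regular_set|lborel. u x t * \<psi> x)
      \<longlongrightarrow> set_lebesgue_integral u0 regular_set \<psi>) (at_right 0)"
    if "Cc_on regular_set \<psi>" for \<psi>
    using u0(2)[OF Cc_on_extend_zero[OF open_regular_set that]]
    unfolding set_integral_eq_pairing by (simp only: set_lebesgue_integral_def)
  moreover have "\<Omega> - (\<Omega> - regular_set) = regular_set"
    using regular_set_subset by blast
  ultimately show ?thesis
    using u0(1) open_regular_set blow_up_at_singular_points
    by (intro exI[of _ "\<Omega> - regular_set"] conjI exI[of _ u0]) auto
qed

end
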